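(* Let $p\in[1,\infty]$ and let $X_n$ be a sequence (in $\mathcal{H}$, with $\|X_n\|_p<\infty$) converging to $X$ in $L^p$. Then, for any $t$, $\mathcal{E}_t(X_n)$ is convergent in $L^p$, and $\mathcal{E}_t(X):=\lim_n\mathcal{E}_t(X_n)$ is uniquely defined (the limit does not depend on the choice of the sequence $X_n$ converging to $X$).
   Context: Let $(\Omega,\mathcal{F})$ be a measurable space with a discrete-time filtration $\{\mathcal{F}_t\}_{t\in\mathbb{N}}$, $\mathbb{N}=\{0,1,2,\dots\}$, such that $\mathcal{F}=\mathcal{F}_\infty=\sigma(\bigcup_t\mathcal{F}_t)$ and $\mathcal{F}_0$ is trivial. $m\mathcal{F}_t$ denotes the $\mathcal{F}_t$-measurable $\mathbb{R}\cup\{\pm\infty\}$-valued functions. $\mathcal{H}$ is a linear space of $\mathcal{F}$-measurable $\mathbb{R}$-valued functions on $\Omega$ containing the constants, such that $X\in\mathcal{H}$ implies $|X|\in\mathcal{H}$ and $I_AX\in\mathcal{H}$ for all $A\in\mathcal{F}$; $\mathcal{H}_t:=\mathcal{H}\cap m\mathcal{F}_t$. $\mathcal{E}$ is an $\mathcal{SL}$-expectation: a family of maps $\mathcal{E}_t:\mathcal{H}\to\mathcal{H}_t$ such that for all $X,Y\in\mathcal{H}$, $s\le t$: (i) $X\ge Y$ implies $\mathcal{E}_t(X)\ge\mathcal{E}_t(Y)$; (ii) $\mathcal{E}_s(Y)=\mathcal{E}_s(\mathcal{E}_t(Y))$; (iii) $\mathcal{E}_t(I_AY)=I_A\mathcal{E}_t(Y)$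 for $A\in\mathcal{F}_t$; (iv) $\mathcal{E}_t(Y)=Y$ for $Y\in\mathcal{H}_t$; (v) $\mathcal{E}_t(X+Y)\le\mathcal{E}_t(X)+\mathcal{E}_t(Y)$; (vi) $\mathcal{E}_t(\lambda Y)=\lambda^+\mathcal{E}_t(Y)+\lambda^-\mathcal{E}_t(-Y)$ for $\lambda\in\mathcal{H}_t$ with $\lambda Y\in\mathcal{H}$; (vii) if $X_i\in\mathcal{H}$ and $X_i(\omega)\downarrow0$ for every $\omega$, then $\mathcal{E}_0(X_i)\to0$. Write $\mathcal{E}=\mathcal{E}_0$ (real-valued). Such $\mathcal{E}$ has a representation $\mathcal{E}(Y)=\sup_{\theta\in\Theta}E_\theta[Y]$ for a collection $\Theta$ of ($\sigma$-additive) probability measures, which is fixed; for nonnegative $\mathcal{F}$-measurable functions not in $\mathcal{H}$, $\mathcal{E}$ is understood as $\sup_{\theta\in\Theta}E_\theta[\cdot]$. For $p\in[1,\infty)$, $\|X\|_p=(\mathcal{E}(|X|^p))^{1/p}$; $\|X\|_\infty=\inf\{x\in\mathbb{R}:\mathcal{E}(I_{\{|X|>x\}})=0\}$. These are seminorms. $L^p$ is the completion under $\|\cdot\|_p$ of $\{X\in\mathcal{H}:\|X\|_p<\infty\}$, modulo equality in $\|\cdot\|_p$. *)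

theory Defs
  imports "HOL-Probability.Probability"
begin

text \<open>
  The state space is \<^term>\<open>space M\<close>, and only the \<open>\<sigma>\<close>-algebras of \<^term>\<open>M\<close> and of the
  \<open>F t\<close> matter, not their measures. Functions on the state space are total functions on \<^typ>\<open>'a\<close>
  whose values outside \<^term>\<open>space M\<close> are irrelevant, so all pointwise (in)equalities
  are required on \<^term>\<open>space M\<close> only.
\<close>

locale function_space_setting = filtration "space M" F
  for M :: "'a measure" and F :: "nat \<Rightarrow> 'a measure" +
  fixes H :: "('a \<Rightarrow> real) set"
  assumes sets_eq_sigma: "sets M = sigma_sets (space M) (\<Union>t. sets (F t))"
    and F_0_trivial: "sets (F 0) = {{}, space M}"
    and H_measurable: "X \<in> H \<Longrightarrow> X \<in> borel_measurable M"
    and H_const: "(\<lambda>\<omega>. c) \<in> H"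
    and H_add: "X \<in> H \<Longrightarrow> Y \<in> H \<Longrightarrow> (\<lambda>\<omega>. X \<omega> + Y \<omega>) \<in> H"
    and H_scale: "X \<in> H \<Longrightarrow> (\<lambda>\<omega>. c * X \<omega>) \<in> H"
    and H_abs: "X \<in> H \<Longrightarrow> (\<lambda>\<omega>. \<bar>X \<omega>\<bar>) \<in> H"
    and H_indicator: "X \<in> H \<Longrightarrow> A \<in> sets M \<Longrightarrow> (\<lambda>\<omega>. indicator A \<omega> * X \<omega>) \<in> H"

text \<open>
  In the last condition, \<open>\<E> 0 (X i)\<close> is constant on \<^term>\<open>space M\<close>, because \<open>F 0\<close> is trivial.
\<close>

locale SL_expectation = function_space_setting M F H
  for M :: "'a measure" and F :: "nat \<Rightarrow> 'a measure" and H :: "('a \<Rightarrow> real) set" +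
  fixes \<E> :: "nat \<Rightarrow> ('a \<Rightarrow> real) \<Rightarrow> 'a \<Rightarrow> real"
  assumes closed: "Y \<in> H \<Longrightarrow> \<E> t Y \<in> H \<inter> borel_measurable (F t)"
    and monotone: "X \<in> H \<Longrightarrow> Y \<in> H \<Longrightarrow> (\<And>\<omega>. \<omega> \<in> space M \<Longrightarrow> Y \<omega> \<le> X \<omega>) \<Longrightarrow>
      \<omega> \<in> space M \<Longrightarrow> \<E> t Y \<omega> \<le> \<E> t X \<omega>"
    and recursive: "Y \<in> H \<Longrightarrow> s \<le> t \<Longrightarrow> \<omega> \<in> space M \<Longrightarrow> \<E> s Y \<omega> = \<E> s (\<E> t Y) \<omega>"
    and local: "Y \<in> H \<Longrightarrow> A \<in> sets (F t) \<Longrightarrow> \<omega> \<in> space M \<Longrightarrow>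
      \<E> t (\<lambda>\<omega>. indicator A \<omega> * Y \<omega>) \<omega> = indicator A \<omega> * \<E> t Y \<omega>"
    and triviality: "Y \<in> H \<Longrightarrow> Y \<in> borel_measurable (F t) \<Longrightarrow> \<omega> \<in> space M \<Longrightarrow> \<E> t Y \<omega> = Y \<omega>"
    and subadditive: "X \<in> H \<Longrightarrow> Y \<in> H \<Longrightarrow> \<omega> \<in> space M \<Longrightarrow>
      \<E> t (\<lambda>\<omega>. X \<omega> + Y \<omega>) \<omega> \<le> \<E> t X \<omega> + \<E> t Y \<omega>"
    and homogeneous: "Y \<in> H \<Longrightarrow> l \<in> H \<Longrightarrow> l \<in> borel_measurable (F t) \<Longrightarrow>
      (\<lambda>\<omega>. l \<omega> * Y \<omega>) \<in> H \<Longrightarrow> \<omega> \<in> space M \<Longrightarrow>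
      \<E> t (\<lambda>\<omega>. l \<omega> * Y \<omega>) \<omega> =
        max (l \<omega>) 0 * \<E> t Y \<omega> + max (- l \<omega>) 0 * \<E> t (\<lambda>\<omega>. - Y \<omega>) \<omega>"
    and continuous: "(\<And>i::nat. Xs i \<in> H) \<Longrightarrow>
      (\<And>\<omega>. \<omega> \<in> space M \<Longrightarrow> decseq (\<lambda>i. Xs i \<omega>) \<and> (\<lambda>i. Xs i \<omega>) \<longlonglongrightarrow> 0) \<Longrightarrow>
      \<omega> \<in> space M \<Longrightarrow> (\<lambda>i. \<E> 0 (Xs i) \<omega>) \<longlonglongrightarrow> 0"

locale represented_SL_expectation = SL_expectation M F H \<E>
  for M :: "'a measure" and F :: "nat \<Rightarrow> 'a measure" and H :: "('a \<Rightarrow> real) set"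
    and \<E> :: "nat \<Rightarrow> ('a \<Rightarrow> real) \<Rightarrow> 'a \<Rightarrow> real" +
  fixes \<Theta> :: "'a measure set"
  assumes prob_space_Theta: "\<theta> \<in> \<Theta> \<Longrightarrow> prob_space \<theta>"
    and sets_Theta: "\<theta> \<in> \<Theta> \<Longrightarrow> sets \<theta> = sets M"
    and integrable_Theta: "\<theta> \<in> \<Theta> \<Longrightarrow> Y \<in> H \<Longrightarrow> integrable \<theta> Y"
    and representation: "Y \<in> H \<Longrightarrow> \<omega> \<in> space M \<Longrightarrow>
      ereal (\<E> 0 Y \<omega>) = (SUP \<theta>\<in>\<Theta>. ereal (\<integral>\<omega>'. Y \<omega>' \<partial>\<theta>))"

text \<open>
  The extension of \<open>\<E> 0\<close> to nonnegative functions outside \<open>H\<close>; the lemma below shows that it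
  agrees with \<open>\<E> 0\<close> on the nonnegative elements of \<open>H\<close>.
\<close>

definition upper_expectation :: "'a measure set \<Rightarrow> ('a \<Rightarrow> ennreal) \<Rightarrow> ennreal" where
  "upper_expectation \<Theta> Y = (SUP \<theta>\<in>\<Theta>. \<integral>\<^sup>+\<omega>. Y \<omega> \<partial>\<theta>)"

lemma (in represented_SL_expectation) upper_expectation_eq:
  assumes Y: "Y \<in> H" and nonneg: "\<And>\<omega>. \<omega> \<in> space M \<Longrightarrow> 0 \<le> Y \<omega>" and w: "\<omega> \<in> space M"
  shows "upper_expectation \<Theta> (\<lambda>\<omega>. ennreal (Y \<omega>)) = ennreal (\<E> 0 Y \<omega>)"
proof -
  have int: "(\<integral>\<^sup>+\<omega>. ennreal (Y \<omega>) \<partial>\<theta>) = ennreal (\<integral>\<omega>. Y \<omega> \<partial>\<theta>)"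
    and le: "(\<integral>\<omega>. Y \<omega> \<partial>\<theta>) \<le> \<E> 0 Y \<omega>" if "\<theta> \<in> \<Theta>" for \<theta>
  proof -
    have "space \<theta> = space M"
      using sets_eq_imp_space_eq[OF sets_Theta[OF that]] .
    then have "AE \<omega> in \<theta>. 0 \<le> Y \<omega>"
      using nonneg by (intro AE_I2) simp
    then show "(\<integral>\<^sup>+\<omega>. ennreal (Y \<omega>) \<partial>\<theta>) = ennreal (\<integral>\<omega>. Y \<omega> \<partial>\<theta>)"
      by (rule nn_integral_eq_integral[OF integrable_Theta[OF that Y]])
    have "ereal (\<integral>\<omega>. Y \<omega> \<partial>\<theta>) \<le> ereal (\<E> 0 Y \<omega>)"
      unfolding representation[OF Y w] by (rule SUP_upper[OF that])
    then show "(\<integral>\<omega>. Y \<omega> \<partial>\<theta>) \<le> \<E> 0 Y \<omega>"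
      by simp
  qed
  have up: "upper_expectation \<Theta> (\<lambda>\<omega>. ennreal (Y \<omega>)) = (SUP \<theta>\<in>\<Theta>. ennreal (\<integral>\<omega>. Y \<omega> \<partial>\<theta>))"
    unfolding upper_expectation_def by (intro SUP_cong refl int)
  have le_up: "upper_expectation \<Theta> (\<lambda>\<omega>. ennreal (Y \<omega>)) \<le> ennreal (\<E> 0 Y \<omega>)"
    unfolding up by (intro SUP_least ennreal_leI le)
  then have "upper_expectation \<Theta> (\<lambda>\<omega>. ennreal (Y \<omega>)) < \<top>"
    by (rule le_less_trans) simp
  then obtain r where r: "0 \<le> r" "upper_expectation \<Theta> (\<lambda>\<omega>. ennreal (Y \<omega>)) = ennreal r"
    by (cases "upper_expectation \<Theta> (\<lambda>\<omega>. ennreal (Y \<omega>))") auto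
  have "(\<integral>\<omega>. Y \<omega> \<partial>\<theta>) \<le> r" if "\<theta> \<in> \<Theta>" for \<theta>
  proof -
    have "ennreal (\<integral>\<omega>. Y \<omega> \<partial>\<theta>) \<le> ennreal r"
      unfolding r(2)[symmetric] up by (rule SUP_upper[OF that])
    then show ?thesis
      using r(1) by (simp add: ennreal_le_iff)
  qed
  then have "ereal (\<E> 0 Y \<omega>) \<le> ereal r"
    unfolding representation[OF Y w] by (intro SUP_least) simp
  then have "ennreal (\<E> 0 Y \<omega>) \<le> ennreal r"
    by (intro ennreal_leI) simp
  with le_up r(2) show ?thesis
    by (intro antisym) simp_all
qed

text \<open>
  The exponent \<open>\<infinity>\<close> is \<^term>\<open>\<top> :: ennreal\<close>. The seminorm is \<open>\<top>\<close> if the upper expectation of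
  \<open>\<bar>X\<bar>\<^sup>p\<close> is infinite or, for \<open>p = \<infinity>\<close>, if no admissible bound \<open>x\<close> exists (\<^term>\<open>Inf {} = (\<top> :: ennreal)\<close>).
\<close>

definition Lp_seminorm :: "'a measure set \<Rightarrow> ennreal \<Rightarrow> ('a \<Rightarrow> real) \<Rightarrow> ennreal" where
  "Lp_seminorm \<Theta> p X =
    (if p = \<top> then Inf {ennreal x | x. upper_expectation \<Theta> (indicator {\<omega>. x < \<bar>X \<omega>\<bar>}) = 0}
     else let m = upper_expectation \<Theta> (\<lambda>\<omega>. ennreal (\<bar>X \<omega>\<bar> powr enn2real p))
       in if m = \<top> then \<top> else ennreal (enn2real m powr (1 / enn2real p)))"

definition Hp :: "('a \<Rightarrow> real) set \<Rightarrow> 'a measure set \<Rightarrow> ennreal \<Rightarrow> ('a \<Rightarrow> real) set" where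
  "Hp H \<Theta> p = {X \<in> H. Lp_seminorm \<Theta> p X < \<top>}"

text \<open>
  The completion is the usual one: Cauchy sequences in \<^const>\<open>Hp\<close>, modulo sequences whose difference
  tends to zero; this also identifies functions that are equal in the seminorm.
\<close>

definition Hp_Cauchy ::
    "('a \<Rightarrow> real) set \<Rightarrow> 'a measure set \<Rightarrow> ennreal \<Rightarrow> (nat \<Rightarrow> 'a \<Rightarrow> real) set" where
  "Hp_Cauchy H \<Theta> p = {Xs. (\<forall>n. Xs n \<in> Hp H \<Theta> p) \<and>
    (\<forall>e>0. \<exists>N. \<forall>m\<ge>N. \<forall>n\<ge>N. Lp_seminorm \<Theta> p (\<lambda>\<omega>. Xs m \<omega> - Xs n \<omega>) < e)}"

definition Hp_equiv ::
    "('a \<Rightarrow> real) set \<Rightarrow> 'a measure set \<Rightarrow> ennreal \<Rightarrow> (nat \<Rightarrow> 'a \<Rightarrow> real) rel" where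
  "Hp_equiv H \<Theta> p = {(Xs, Ys). Xs \<in> Hp_Cauchy H \<Theta> p \<and> Ys \<in> Hp_Cauchy H \<Theta> p \<and>
    (\<lambda>n. Lp_seminorm \<Theta> p (\<lambda>\<omega>. Xs n \<omega> - Ys n \<omega>)) \<longlonglongrightarrow> 0}"

definition Lp ::
    "('a \<Rightarrow> real) set \<Rightarrow> 'a measure set \<Rightarrow> ennreal \<Rightarrow> (nat \<Rightarrow> 'a \<Rightarrow> real) set set" where
  "Lp H \<Theta> p = Hp_Cauchy H \<Theta> p // Hp_equiv H \<Theta> p"

definition Lp_embed ::
    "('a \<Rightarrow> real) set \<Rightarrow> 'a measure set \<Rightarrow> ennreal \<Rightarrow> ('a \<Rightarrow> real) \<Rightarrow> (nat \<Rightarrow> 'a \<Rightarrow> real) set" where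
  "Lp_embed H \<Theta> p X = Hp_equiv H \<Theta> p `` {\<lambda>n. X}"

text \<open>
  The value \<open>0\<close> outside \<^const>\<open>Lp\<close> is there because \<^locale>\<open>Metric_space\<close> requires nonnegativity
  and symmetry for all arguments.
\<close>

definition Lp_dist :: "('a \<Rightarrow> real) set \<Rightarrow> 'a measure set \<Rightarrow> ennreal \<Rightarrow>
    (nat \<Rightarrow> 'a \<Rightarrow> real) set \<Rightarrow> (nat \<Rightarrow> 'a \<Rightarrow> real) set \<Rightarrow> real" where
  "Lp_dist H \<Theta> p A B =
    (if A \<in> Lp H \<Theta> p \<and> B \<in> Lp H \<Theta> p
     then THE d. \<forall>Xs\<in>A. \<forall>Ys\<in>B. (\<lambda>n. enn2real (Lp_seminorm \<Theta> p (\<lambda>\<omega>. Xs n \<omega> - Ys n \<omega>))) \<longlonglongrightarrow> d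
     else 0)"

definition Lp_topology ::
    "('a \<Rightarrow> real) set \<Rightarrow> 'a measure set \<Rightarrow> ennreal \<Rightarrow> (nat \<Rightarrow> 'a \<Rightarrow> real) set topology" where
  "Lp_topology H \<Theta> p = Metric_space.mtopology (Lp H \<Theta> p) (Lp_dist H \<Theta> p)"

definition converges_in_Lp :: "('a \<Rightarrow> real) set \<Rightarrow> 'a measure set \<Rightarrow> ennreal \<Rightarrow>
    (nat \<Rightarrow> 'a \<Rightarrow> real) \<Rightarrow> (nat \<Rightarrow> 'a \<Rightarrow> real) set \<Rightarrow> bool" where
  "converges_in_Lp H \<Theta> p Xs X \<longleftrightarrow>
    (\<forall>n. Xs n \<in> Hp H \<Theta> p) \<and>
    limitin (Lp_topology H \<Theta> p) (\<lambda>n. Lp_embed H \<Theta> p (Xs n)) X sequentially"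

end

theory Submission
  imports Defs
begin

text \<open>
  \<open>\<E> t\<close> is a contraction for the seminorm, hence preserves Cauchy sequences and their equivalence.
  From \<open>\<bar>\<E> t X - \<E> t Y\<bar> \<le> \<E> t \<bar>X - Y\<bar>\<close>, contractivity reduces to Jensen's inequality for
  nonnegative functions. Since \<open>\<bar>X\<bar>\<^sup>p\<close> may lie outside \<open>H\<close>, Jensen's inequality is applied to maxima of
  finitely many affine functions, under which the vector lattice \<open>H\<close> is stable: they increase to
  \<open>x\<^sup>p\<close> and monotone convergence under each \<open>\<theta>\<close> gives \<open>p < \<infinity>\<close>; the single function
  \<open>max 0 (x - c)\<close> gives \<open>p = \<infinity>\<close>.
  In the completion, \<open>Xs\<close> converges to the class \<open>X\<close> if and only if \<open>Xs \<in> X\<close>.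
\<close>

subsection \<open>Powers as suprema of affine functions\<close>

text \<open>At x = 0 the inequality reduces to \<open>(1 - r) * q powr r \<le> 0\<close>; at
  positive x it says that the convex power lies above its tangent at q.\<close>

lemma powr_ge_tangent:
  fixes x q r :: real
  assumes "1 \<le> r" "0 < q" "0 \<le> x"
  shows "q powr r + r * q powr (r - 1) * (x - q) \<le> x powr r"
proof (cases "x = 0")
  case True
  have "q powr r = q powr (r - 1) * q"
    using assms powr_add[of q "r - 1" 1] by simp
  then have "q powr r + r * q powr (r - 1) * (x - q) = (1 - r) * q powr r"
    using True by (simp add: algebra_simps)
  also have "\<dots> \<le> 0"
    using assms by (intro mult_nonpos_nonneg) auto
  finally show ?thesis
    using True by simp
next
  case False
  have "((\<lambda>x. x powr r) has_real_derivative r * q powr (r - 1)) (at q)"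
    using assms by (auto intro!: derivative_eq_intros)
  then have "x powr r - q powr r \<ge> r * q powr (r - 1) * (x - q)"
    using assms False
    by (intro convex_on_imp_above_tangent[OF powr_convex[OF assms(1)]])
       (auto simp: interior_open intro: has_field_derivative_at_within convex_connected)
  then show ?thesis
    by simp
qed

text \<open>Convexity including the endpoint 0, in the form used for Minkowski's inequality. The
  tangent at the mean \<open>\<alpha> * u + \<beta> * v\<close> bounds the power from below at u and
  at v, and its linear terms cancel in the weighted sum.\<close>

lemma powr_convex_combination:
  fixes u v \<alpha> \<beta> r :: real
  assumes r: "1 \<le> r" and uv: "0 \<le> u" "0 \<le> v" and ab: "0 \<le> \<alpha>" "0 \<le> \<beta>" "\<alpha> + \<beta> = 1"
  shows "(\<alpha> * u + \<beta> * v) powr r \<le> \<alpha> * u powr r + \<beta> * v powr r"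
proof (cases "\<alpha> * u + \<beta> * v = 0")
  case True
  then show ?thesis using ab by simp
next
  case False
  define q where "q = \<alpha> * u + \<beta> * v"
  have "0 \<le> q"
    unfolding q_def using uv ab by simp
  with False have q: "0 < q"
    unfolding q_def by simp
  define k where "k = r * q powr (r - 1)"
  have "\<alpha> * (q powr r + k * (u - q)) + \<beta> * (q powr r + k * (v - q))
      \<le> \<alpha> * u powr r + \<beta> * v powr r"
    unfolding k_def using r q uv ab by (intro add_mono mult_left_mono powr_ge_tangent)
  moreover have "\<alpha> * (q powr r + k * (u - q)) + \<beta> * (q powr r + k * (v - q))
      = (\<alpha> + \<beta>) * q powr r + k * ((\<alpha> * u + \<beta> * v) - (\<alpha> + \<beta>) * q)"
    by (simp add: algebra_simps)
  ultimately show ?thesis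
    using ab unfolding q_def by simp
qed

text \<open>Starting from 0 keeps every value nonnegative, so that \<open>ennreal\<close> loses
  nothing, and makes the case n = 1 the positive part of a single affine function.\<close>

primrec max_affine :: "(nat \<Rightarrow> real) \<Rightarrow> (nat \<Rightarrow> real) \<Rightarrow> nat \<Rightarrow> real \<Rightarrow> real" where
  "max_affine a b 0 x = 0"
| "max_affine a b (Suc n) x = max (max_affine a b n x) (a n * x + b n)"

lemma max_affine_nonneg: "0 \<le> max_affine a b n x"
  by (induction n) auto

lemma max_affine_ge: "k < n \<Longrightarrow> a k * x + b k \<le> max_affine a b n x"
  by (induction n) (auto simp: less_Suc_eq)

lemma max_affine_le:
  assumes "0 \<le> c" "\<And>k. a k * x + b k \<le> c"
  shows "max_affine a b n x \<le> c"
  by (induction n) (use assms in auto)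

text \<open>The affine functions are the tangents at the positive rationals. Their slopes are
  recorded as nonnegative because a sublinear expectation lets only nonnegative factors pass through
  unchanged.\<close>

lemma powr_eq_SUP_max_affine:
  fixes r :: real
  assumes r: "1 \<le> r"
  obtains a b where "\<And>k. 0 \<le> a k"
    "\<And>x. 0 \<le> x \<Longrightarrow> ennreal (x powr r) = (SUP n. ennreal (max_affine a b n x))"
proof -
  define q :: "nat \<Rightarrow> real" where "q = from_nat_into {s \<in> \<rat>. 0 < s}"
  have ne: "{s \<in> \<rat>. 0 < s} \<noteq> ({} :: real set)"
    using Rats_1 zero_less_one by blast
  have cnt: "countable {s \<in> \<rat>. (0::real) < s}"
    using countable_rat by (rule countable_subset[rotated]) auto
  have ran: "range q = {s \<in> \<rat>. 0 < s}"
    unfolding q_def using ne cnt by (rule range_from_nat_into)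
  \<comment> \<open>Slope and intercept of the tangent at \<open>q k\<close>.\<close>
  define a b where "a k = r * q k powr (r - 1)" and "b k = q k powr r - a k * q k" for k
  have tangent: "a k * x + b k = q k powr r + r * q k powr (r - 1) * (x - q k)" for k x
    unfolding a_def b_def by (simp add: algebra_simps)
  have le: "max_affine a b n x \<le> x powr r" if "0 \<le> x" for n x
  proof (rule max_affine_le)
    fix k
    have "0 < q k" using ran by auto
    then show "a k * x + b k \<le> x powr r"
      unfolding tangent using r that by (intro powr_ge_tangent)
  qed simp
  \<comment> \<open>For fixed x, the value at x of the tangent at s depends continuously on s and
    equals \<open>x powr r\<close> at s = x, so a rational s near x gives a value above y.\<close>
  have ex: "\<exists>n. y < max_affine a b n x" if "0 < x" "y < x powr r" for x y
  proof -
    have "((\<lambda>s. s powr r + r * s powr (r - 1) * (x - s)) \<longlongrightarrow>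
        x powr r + r * x powr (r - 1) * (x - x)) (at x)"
      using that by (intro tendsto_intros) auto
    then have "eventually (\<lambda>s. y < s powr r + r * s powr (r - 1) * (x - s)) (at x)"
      using that by (intro order_tendstoD(1)) auto
    then obtain d where d: "d > 0"
      "\<And>s. s \<noteq> x \<Longrightarrow> dist s x < d \<Longrightarrow> y < s powr r + r * s powr (r - 1) * (x - s)"
      unfolding eventually_at by auto
    \<comment> \<open>Choosing s to the right of x keeps it positive and different from x, as the
      punctured neighbourhood demands.\<close>
    obtain s where s: "s \<in> \<rat>" "x < s" "s < x + d"
      using Rats_dense_in_real[of x "x + d"] d(1) by auto
    have "s \<in> range q" unfolding ran using s that by auto
    then obtain k where k: "s = q k" by auto
    have "y < a k * x + b k"
      unfolding tangent k[symmetric] using s by (intro d(2)) (auto simp: dist_real_def)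
    also have "\<dots> \<le> max_affine a b (Suc k) x"
      by (rule max_affine_ge) simp
    finally show ?thesis by blast
  qed
  show ?thesis
  proof
    show "0 \<le> a k" for k
      unfolding a_def using r by simp
    fix x :: real
    assume x: "0 \<le> x"
    show "ennreal (x powr r) = (SUP n. ennreal (max_affine a b n x))"
    proof (rule antisym)
      show "(SUP n. ennreal (max_affine a b n x)) \<le> ennreal (x powr r)"
        using le[OF x] by (intro SUP_least ennreal_leI)
      show "ennreal (x powr r) \<le> (SUP n. ennreal (max_affine a b n x))"
      proof (cases "x = 0")
        case False
        show ?thesis
        proof (rule dense_le)
          fix z assume z: "z < ennreal (x powr r)"
          then obtain y where y: "0 \<le> y" "z = ennreal y"
            by (cases z) auto
          with z have "y < x powr r"
            by (simp add: ennreal_less_iff)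
          with ex[of x y] x False obtain n where "y < max_affine a b n x"
            by auto
          then show "z \<le> (SUP n. ennreal (max_affine a b n x))"
            unfolding y by (intro SUP_upper2[of n]) (auto intro: ennreal_leI)
        qed
      qed simp
    qed
  qed
qed

subsection \<open>Jensen's inequality\<close>

context function_space_setting
begin

lemma H_diff:
  assumes "X \<in> H" "Y \<in> H"
  shows "(\<lambda>\<omega>. X \<omega> - Y \<omega>) \<in> H"
  using H_add[OF assms(1) H_scale[OF assms(2), of "-1"]] by simp

lemma H_max:
  assumes "X \<in> H" "Y \<in> H"
  shows "(\<lambda>\<omega>. max (X \<omega>) (Y \<omega>)) \<in> H"
proof -
  have "(\<lambda>\<omega>. max (X \<omega>) (Y \<omega>)) = (\<lambda>\<omega>. (1/2) * ((X \<omega> + Y \<omega>) + \<bar>X \<omega> - Y \<omega>\<bar>))"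
    by (auto simp: fun_eq_iff max_def field_simps)
  also have "\<dots> \<in> H"
    by (intro H_scale H_add H_abs H_diff assms)
  finally show ?thesis .
qed

lemma H_affine: "X \<in> H \<Longrightarrow> (\<lambda>\<omega>. c * X \<omega> + d) \<in> H"
  by (intro H_add H_scale H_const)

lemma H_max_affine:
  assumes "X \<in> H"
  shows "(\<lambda>\<omega>. max_affine a b n (X \<omega>)) \<in> H"
proof (induction n)
  case (Suc n)
  then show ?case
    unfolding max_affine.simps by (intro H_max H_affine assms)
qed (simp add: H_const)

end

section \<open>Pointwise inequalities for \<open>\<E> t\<close>\<close>

context SL_expectation
begin

lemma E_H: "Y \<in> H \<Longrightarrow> \<E> t Y \<in> H"
  using closed by blast

lemma E_const: "\<omega> \<in> space M \<Longrightarrow> \<E> t (\<lambda>_. c) \<omega> = c"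
  by (intro triviality H_const) auto

lemma E_nonneg:
  assumes "Y \<in> H" "\<And>\<omega>. \<omega> \<in> space M \<Longrightarrow> 0 \<le> Y \<omega>" "\<omega> \<in> space M"
  shows "0 \<le> \<E> t Y \<omega>"
  using monotone[OF assms(1) H_const assms(2) assms(3), of t] E_const[OF assms(3), of t 0] by simp

text \<open>Subadditivity applied directly would give the opposite inequality. It is applied instead
  to the sum of \<open>c * X \<omega> + d\<close> and the constant \<open>- d\<close>, and
  \<open>\<E> t\<close> fixes constants.\<close>

lemma E_affine_ge:
  assumes X: "X \<in> H" and c: "0 \<le> c" and w: "\<omega> \<in> space M"
  shows "c * \<E> t X \<omega> + d \<le> \<E> t (\<lambda>\<omega>. c * X \<omega> + d) \<omega>"
proof -
  have "\<E> t (\<lambda>\<omega>. (c * X \<omega> + d) + (- d)) \<omega> \<le> \<E> t (\<lambda>\<omega>. c * X \<omega> + d) \<omega> + \<E> t (\<lambda>_. - d) \<omega>"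
    by (intro subadditive H_affine H_const X w)
  moreover have "\<E> t (\<lambda>\<omega>. c * X \<omega>) \<omega> = c * \<E> t X \<omega>"
    using homogeneous[OF X H_const _ H_scale[OF X] w, of c t] c by simp
  ultimately show ?thesis
    using E_const[OF w, of t "- d"] by simp
qed

text \<open>Conditional Jensen for finite maxima: by monotonicity the right-hand side dominates the
  expectation of each affine piece, hence each piece evaluated at \<open>\<E> t X\<close>.\<close>

lemma max_affine_E_le:
  assumes X: "X \<in> H" and a: "\<And>k. 0 \<le> a k" and w: "\<omega> \<in> space M"
  shows "max_affine a b n (\<E> t X \<omega>) \<le> \<E> t (\<lambda>\<omega>. max_affine a b n (X \<omega>)) \<omega>"
proof (induction n)
  case 0
  show ?case using E_const[OF w, of t 0] by simp
next
  case (Suc n)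
  have "\<E> t (\<lambda>\<omega>. max_affine a b n (X \<omega>)) \<omega> \<le> \<E> t (\<lambda>\<omega>. max_affine a b (Suc n) (X \<omega>)) \<omega>"
    by (intro monotone H_max_affine X w) simp
  moreover have "\<E> t (\<lambda>\<omega>. a n * X \<omega> + b n) \<omega> \<le> \<E> t (\<lambda>\<omega>. max_affine a b (Suc n) (X \<omega>)) \<omega>"
    by (intro monotone H_max_affine H_affine X w) simp
  moreover have "a n * \<E> t X \<omega> + b n \<le> \<E> t (\<lambda>\<omega>. a n * X \<omega> + b n) \<omega>"
    by (intro E_affine_ge X a w)
  ultimately show ?case
    using Suc by simp
qed

text \<open>\<open>\<E> t\<close> is not linear, so the difference is controlled by subadditivity on
  X = Y + (X - Y), and symmetrically with X and Y exchanged.\<close>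

lemma abs_E_diff_le:
  assumes X: "X \<in> H" and Y: "Y \<in> H" and w: "\<omega> \<in> space M"
  shows "\<bar>\<E> t X \<omega> - \<E> t Y \<omega>\<bar> \<le> \<E> t (\<lambda>\<omega>. \<bar>X \<omega> - Y \<omega>\<bar>) \<omega>"
proof -
  have *: "\<E> t X \<omega> - \<E> t Y \<omega> \<le> \<E> t (\<lambda>\<omega>. \<bar>X \<omega> - Y \<omega>\<bar>) \<omega>" if X: "X \<in> H" and Y: "Y \<in> H" for X Y
  proof -
    have "\<E> t (\<lambda>\<omega>. Y \<omega> + (X \<omega> - Y \<omega>)) \<omega> \<le> \<E> t Y \<omega> + \<E> t (\<lambda>\<omega>. X \<omega> - Y \<omega>) \<omega>"
      by (intro subadditive H_diff X Y w)
    moreover have "\<E> t (\<lambda>\<omega>. X \<omega> - Y \<omega>) \<omega> \<le> \<E> t (\<lambda>\<omega>. \<bar>X \<omega> - Y \<omega>\<bar>) \<omega>"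
      by (intro monotone H_abs H_diff X Y w) simp
    ultimately show ?thesis by simp
  qed
  show ?thesis
    using *[OF X Y] *[OF Y X] by (simp add: abs_le_iff abs_minus_commute)
qed

end

section \<open>Jensen's inequality under the upper expectation\<close>

context represented_SL_expectation
begin

lemma space_Theta: "\<theta> \<in> \<Theta> \<Longrightarrow> space \<theta> = space M"
  by (rule sets_eq_imp_space_eq[OF sets_Theta])

lemma measurable_Theta: "\<theta> \<in> \<Theta> \<Longrightarrow> f \<in> measurable M N \<Longrightarrow> f \<in> measurable \<theta> N"
  by (subst measurable_cong_sets[OF sets_Theta refl])

lemma upper_expectation_mono:
  assumes "\<And>\<omega>. \<omega> \<in> space M \<Longrightarrow> f \<omega> \<le> g \<omega>"
  shows "upper_expectation \<Theta> f \<le> upper_expectation \<Theta> g"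
  unfolding upper_expectation_def
  by (intro SUP_mono' SUP_subset_mono order_refl nn_integral_mono) (simp add: space_Theta assms)

lemma upper_expectation_combination:
  assumes f: "f \<in> borel_measurable M" and g: "g \<in> borel_measurable M"
  shows "upper_expectation \<Theta> (\<lambda>\<omega>. c * f \<omega> + d * g \<omega>)
    \<le> c * upper_expectation \<Theta> f + d * upper_expectation \<Theta> g"
proof -
  have "(\<integral>\<^sup>+\<omega>. c * f \<omega> + d * g \<omega> \<partial>\<theta>)
      \<le> c * upper_expectation \<Theta> f + d * upper_expectation \<Theta> g" if "\<theta> \<in> \<Theta>" for \<theta>
  proof -
    note [measurable] = measurable_Theta[OF that f] measurable_Theta[OF that g]
    have "(\<integral>\<^sup>+\<omega>. c * f \<omega> + d * g \<omega> \<partial>\<theta>) = c * (\<integral>\<^sup>+\<omega>. f \<omega> \<partial>\<theta>) + d * (\<integral>\<^sup>+\<omega>. g \<omega> \<partial>\<theta>)"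
      by (simp add: nn_integral_add nn_integral_cmult)
    also have "\<dots> \<le> c * upper_expectation \<Theta> f + d * upper_expectation \<Theta> g"
      unfolding upper_expectation_def using that
      by (intro add_mono mult_left_mono SUP_upper) auto
    finally show ?thesis .
  qed
  then show ?thesis
    by (subst (1) upper_expectation_def) (rule SUP_least)
qed

lemma upper_expectation_eq_0_iff:
  assumes "f \<in> borel_measurable M"
  shows "upper_expectation \<Theta> f = 0 \<longleftrightarrow> (\<forall>\<theta>\<in>\<Theta>. AE \<omega> in \<theta>. f \<omega> = 0)"
proof -
  have "upper_expectation \<Theta> f = 0 \<longleftrightarrow> (\<forall>\<theta>\<in>\<Theta>. (\<integral>\<^sup>+\<omega>. f \<omega> \<partial>\<theta>) = 0)"
    unfolding upper_expectation_def bot_ennreal[symmetric] by (rule SUP_bot_conv(1))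
  also have "\<dots> \<longleftrightarrow> (\<forall>\<theta>\<in>\<Theta>. AE \<omega> in \<theta>. f \<omega> = 0)"
    by (intro ball_cong refl nn_integral_0_iff_AE measurable_Theta[OF _ assms])
  finally show ?thesis .
qed

text \<open>This is the tower property between times 0 and t, since the upper expectation agrees
  with \<open>\<E> 0\<close> on nonnegative elements of \<open>H\<close>.\<close>

lemma upper_expectation_E:
  assumes Y: "Y \<in> H" and nonneg: "\<And>\<omega>. \<omega> \<in> space M \<Longrightarrow> 0 \<le> Y \<omega>"
  shows "upper_expectation \<Theta> (\<lambda>\<omega>. ennreal (\<E> t Y \<omega>)) = upper_expectation \<Theta> (\<lambda>\<omega>. ennreal (Y \<omega>))"
proof (cases "space M = {}")
  \<comment> \<open>The comparison with \<open>\<E> 0\<close> is made at a point of the space. An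
    empty space carries no probability measure, so both suprema run over the empty set.\<close>
  case True
  then have "\<Theta> = {}"
    using prob_space.not_empty[OF prob_space_Theta] space_Theta by blast
  then show ?thesis by (simp add: upper_expectation_def)
next
  case False
  then obtain \<omega> where w: "\<omega> \<in> space M" by blast
  show ?thesis
    using upper_expectation_eq[OF Y nonneg w] recursive[OF Y _ w, of 0 t]
      upper_expectation_eq[OF E_H[OF Y, of t] E_nonneg[OF Y nonneg] w] by simp
qed

lemma upper_expectation_max_affine_E_le:
  assumes X: "X \<in> H" and a: "\<And>k. 0 \<le> a k"
  shows "upper_expectation \<Theta> (\<lambda>\<omega>. ennreal (max_affine a b n (\<E> t X \<omega>)))
    \<le> upper_expectation \<Theta> (\<lambda>\<omega>. ennreal (max_affine a b n (X \<omega>)))"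
proof -
  have "upper_expectation \<Theta> (\<lambda>\<omega>. ennreal (max_affine a b n (\<E> t X \<omega>)))
      \<le> upper_expectation \<Theta> (\<lambda>\<omega>. ennreal (\<E> t (\<lambda>\<omega>. max_affine a b n (X \<omega>)) \<omega>))"
    by (intro upper_expectation_mono ennreal_leI max_affine_E_le X a)
  also have "\<dots> = upper_expectation \<Theta> (\<lambda>\<omega>. ennreal (max_affine a b n (X \<omega>)))"
    by (intro upper_expectation_E H_max_affine X max_affine_nonneg)
  finally show ?thesis .
qed

text \<open>The supremum over n is moved through the integral under one fixed \<theta>; the bound
  obtained for each n depends neither on n nor on \<theta>, so both suprema can then be
  taken.\<close>

lemma upper_expectation_powr_E_le:
  assumes X: "X \<in> H" and nonneg: "\<And>\<omega>. \<omega> \<in> space M \<Longrightarrow> 0 \<le> X \<omega>" and r: "1 \<le> r"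
  shows "upper_expectation \<Theta> (\<lambda>\<omega>. ennreal (\<E> t X \<omega> powr r))
    \<le> upper_expectation \<Theta> (\<lambda>\<omega>. ennreal (X \<omega> powr r))"
proof -
  obtain a b where a: "\<And>k. 0 \<le> a k"
    and SUP: "\<And>x. 0 \<le> x \<Longrightarrow> ennreal (x powr r) = (SUP n. ennreal (max_affine a b n x))"
    using powr_eq_SUP_max_affine[OF r] by blast
  have "(\<integral>\<^sup>+\<omega>. ennreal (\<E> t X \<omega> powr r) \<partial>\<theta>) \<le> upper_expectation \<Theta> (\<lambda>\<omega>. ennreal (X \<omega> powr r))"
    if "\<theta> \<in> \<Theta>" for \<theta>
  proof -
    have "(\<integral>\<^sup>+\<omega>. ennreal (\<E> t X \<omega> powr r) \<partial>\<theta>)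
        = (\<integral>\<^sup>+\<omega>. (SUP n. ennreal (max_affine a b n (\<E> t X \<omega>))) \<partial>\<theta>)"
      by (intro nn_integral_cong SUP E_nonneg X nonneg) (simp_all add: space_Theta[OF that])
    also have "\<dots> = (SUP n. \<integral>\<^sup>+\<omega>. ennreal (max_affine a b n (\<E> t X \<omega>)) \<partial>\<theta>)"
    proof (rule nn_integral_monotone_convergence_SUP)
      show "incseq (\<lambda>n \<omega>. ennreal (max_affine a b n (\<E> t X \<omega>)))"
        by (intro incseq_SucI le_funI ennreal_leI) simp
      show "(\<lambda>\<omega>. ennreal (max_affine a b n (\<E> t X \<omega>))) \<in> borel_measurable \<theta>" for n
        by (intro measurable_Theta[OF that] measurable_compose[OF _ measurable_ennreal]
            H_measurable H_max_affine E_H X)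
    qed
    also have "\<dots> \<le> upper_expectation \<Theta> (\<lambda>\<omega>. ennreal (X \<omega> powr r))"
    proof (rule SUP_least)
      fix n
      \<comment> \<open>The chain leaves the single \<theta> here, because the tower property is
        available for the supremum over \<Theta> and not for an individual measure.\<close>
      have "(\<integral>\<^sup>+\<omega>. ennreal (max_affine a b n (\<E> t X \<omega>)) \<partial>\<theta>)
          \<le> upper_expectation \<Theta> (\<lambda>\<omega>. ennreal (max_affine a b n (\<E> t X \<omega>)))"
        unfolding upper_expectation_def by (rule SUP_upper[OF that])
      also have "\<dots> \<le> upper_expectation \<Theta> (\<lambda>\<omega>. ennreal (max_affine a b n (X \<omega>)))"
        by (intro upper_expectation_max_affine_E_le X a)
      also have "\<dots> \<le> upper_expectation \<Theta> (\<lambda>\<omega>. ennreal (X \<omega> powr r))"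
        by (intro upper_expectation_mono) (auto simp: SUP[OF nonneg] intro: SUP_upper)
      finally show "(\<integral>\<^sup>+\<omega>. ennreal (max_affine a b n (\<E> t X \<omega>)) \<partial>\<theta>)
          \<le> upper_expectation \<Theta> (\<lambda>\<omega>. ennreal (X \<omega> powr r))" .
    qed
    finally show ?thesis .
  qed
  then show ?thesis
    by (subst upper_expectation_def) (rule SUP_least)
qed

text \<open>With slope 1 and intercept -c, \<open>?m y\<close> is max 0 (y - c), which vanishes
  exactly when y \<le> c. Its upper expectation is zero at X, hence by Jensen at
  \<open>\<E> t X\<close>, and a zero upper expectation means vanishing almost everywhere under
  every \<theta>.\<close>

lemma AE_E_le:
  assumes X: "X \<in> H" and le: "\<And>\<theta>. \<theta> \<in> \<Theta> \<Longrightarrow> AE \<omega> in \<theta>. X \<omega> \<le> c" and "\<theta> \<in> \<Theta>"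
  shows "AE \<omega> in \<theta>. \<E> t X \<omega> \<le> c"
proof -
  let ?m = "max_affine (\<lambda>_. 1) (\<lambda>_. - c) 1"
  have meas: "(\<lambda>\<omega>. ennreal (?m (Y \<omega>))) \<in> borel_measurable M" if "Y \<in> H" for Y
    by (intro measurable_compose[OF _ measurable_ennreal] H_measurable H_max_affine that)
  have iff: "ennreal (?m y) = 0 \<longleftrightarrow> y \<le> c" for y
    by (auto simp: max_def)
  have "upper_expectation \<Theta> (\<lambda>\<omega>. ennreal (?m (X \<omega>))) = 0"
    unfolding upper_expectation_eq_0_iff[OF meas[OF X]] iff using le by blast
  then have "upper_expectation \<Theta> (\<lambda>\<omega>. ennreal (?m (\<E> t X \<omega>))) = 0"
    using upper_expectation_max_affine_E_le[OF X, of "\<lambda>_. 1" "\<lambda>_. - c" 1 t] by simp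
  then show ?thesis
    unfolding upper_expectation_eq_0_iff[OF meas[OF E_H[OF X]]] iff using assms(3) by blast
qed

end

subsection \<open>The seminorm\<close>

locale SL_expectation_exponent = represented_SL_expectation M F H \<E> \<Theta>
  for M :: "'a measure" and F :: "nat \<Rightarrow> 'a measure" and H :: "('a \<Rightarrow> real) set"
    and \<E> :: "nat \<Rightarrow> ('a \<Rightarrow> real) \<Rightarrow> 'a \<Rightarrow> real" and \<Theta> :: "'a measure set" +
  fixes p :: ennreal
  assumes p_ge_1: "1 \<le> p"
begin

lemma enn2real_p_ge_1: "p \<noteq> \<top> \<Longrightarrow> 1 \<le> enn2real p"
  using p_ge_1 by (cases p) auto

text \<open>Turns a seminorm bound into a bound on the p-th moment, so that later arguments deal
  neither with the root nor with infinite moments.\<close>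

lemma Lp_seminorm_le_iff_finite:
  assumes "p \<noteq> \<top>" "0 \<le> c"
  shows "Lp_seminorm \<Theta> p X \<le> ennreal c \<longleftrightarrow>
    upper_expectation \<Theta> (\<lambda>\<omega>. ennreal (\<bar>X \<omega>\<bar> powr enn2real p)) \<le> ennreal (c powr enn2real p)"
proof (cases "upper_expectation \<Theta> (\<lambda>\<omega>. ennreal (\<bar>X \<omega>\<bar> powr enn2real p))")
  case (real k)
  let ?r = "enn2real p"
  have r: "0 < ?r" using enn2real_p_ge_1[OF assms(1)] by simp
  have "k powr (1 / ?r) \<le> c \<longleftrightarrow> k \<le> c powr ?r"
  proof
    assume "k powr (1 / ?r) \<le> c"
    then have "(k powr (1 / ?r)) powr ?r \<le> c powr ?r"
      using r by (intro powr_mono2) auto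
    then show "k \<le> c powr ?r" using r real by (simp add: powr_powr)
  next
    assume "k \<le> c powr ?r"
    then have "k powr (1 / ?r) \<le> (c powr ?r) powr (1 / ?r)"
      using r real by (intro powr_mono2) auto
    then show "k powr (1 / ?r) \<le> c" using r assms by (simp add: powr_powr)
  qed
  then show ?thesis
    using real assms by (simp add: Lp_seminorm_def Let_def)
next
  case top
  then show ?thesis
    using assms by (simp add: Lp_seminorm_def Let_def top_unique)
qed

text \<open>The infimum is attained: the bounds c + 1/(n+1) fail only on null sets, and a countable
  union of these is null.\<close>

lemma Lp_seminorm_le_iff_infinite:
  assumes "p = \<top>" "0 \<le> c" and X: "X \<in> borel_measurable M"
  shows "Lp_seminorm \<Theta> p X \<le> ennreal c \<longleftrightarrow> (\<forall>\<theta>\<in>\<Theta>. AE \<omega> in \<theta>. \<bar>X \<omega>\<bar> \<le> c)"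
proof -
  have iff: "upper_expectation \<Theta> (indicator {\<omega>. x < \<bar>X \<omega>\<bar>}) = 0 \<longleftrightarrow>
      (\<forall>\<theta>\<in>\<Theta>. AE \<omega> in \<theta>. \<bar>X \<omega>\<bar> \<le> x)" for x
  proof -
    have eq: "indicator {\<omega>. x < \<bar>X \<omega>\<bar>} = (\<lambda>\<omega>. if x < \<bar>X \<omega>\<bar> then 1 else (0::ennreal))"
      by (auto simp: fun_eq_iff indicator_def)
    have "(\<lambda>\<omega>. if x < \<bar>X \<omega>\<bar> then 1 else (0::ennreal)) \<in> borel_measurable M"
      using X by measurable
    from upper_expectation_eq_0_iff[OF this] show ?thesis
      unfolding eq by (simp add: not_less)
  qed
  have N: "Lp_seminorm \<Theta> p X = Inf {ennreal x |x. \<forall>\<theta>\<in>\<Theta>. AE \<omega> in \<theta>. \<bar>X \<omega>\<bar> \<le> x}"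
    unfolding Lp_seminorm_def iff using assms(1) by simp
  show ?thesis
  proof
    assume le: "Lp_seminorm \<Theta> p X \<le> ennreal c"
    show "\<forall>\<theta>\<in>\<Theta>. AE \<omega> in \<theta>. \<bar>X \<omega>\<bar> \<le> c"
    proof
      fix \<theta> assume \<theta>: "\<theta> \<in> \<Theta>"
      have "AE \<omega> in \<theta>. \<bar>X \<omega>\<bar> \<le> c + 1 / Suc n" for n
      proof -
        have "ennreal c < ennreal (c + 1 / Suc n)"
          using assms(2) by (simp add: ennreal_less_iff)
        then have "Lp_seminorm \<Theta> p X < ennreal (c + 1 / Suc n)"
          using le by (rule le_less_trans[rotated])
        then obtain x where x: "ennreal x < ennreal (c + 1 / Suc n)"
          "\<forall>\<theta>\<in>\<Theta>. AE \<omega> in \<theta>. \<bar>X \<omega>\<bar> \<le> x"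
          unfolding N Inf_less_iff by blast
        \<comment> \<open>The witness x is an arbitrary real, possibly negative, so the comparison
          is pulled back through the monotone \<open>ennreal\<close> by contraposition.\<close>
        from x(1) have "x \<le> c + 1 / Suc n"
          using ennreal_leI[of "c + 1 / Suc n" x] by (meson leD le_cases)
        moreover have "AE \<omega> in \<theta>. \<bar>X \<omega>\<bar> \<le> x"
          using x(2) \<theta> by blast
        ultimately show ?thesis by auto
      qed
      then have "AE \<omega> in \<theta>. \<forall>n. \<bar>X \<omega>\<bar> \<le> c + 1 / Suc n"
        by (simp add: AE_all_countable)
      then show "AE \<omega> in \<theta>. \<bar>X \<omega>\<bar> \<le> c"
      proof eventually_elim
        case (elim \<omega>)
        have "(\<lambda>n. c + 1 / Suc n) \<longlonglongrightarrow> c + 0"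
          by (rule tendsto_add[OF tendsto_const LIMSEQ_Suc[OF lim_1_over_n]])
        then show ?case
          using elim by (intro LIMSEQ_le_const) auto
      qed
    qed
  next
    assume "\<forall>\<theta>\<in>\<Theta>. AE \<omega> in \<theta>. \<bar>X \<omega>\<bar> \<le> c"
    then show "Lp_seminorm \<Theta> p X \<le> ennreal c"
      unfolding N by (intro Inf_lower) blast
  qed
qed

section \<open>Monotonicity and Minkowski's inequality\<close>

lemma Lp_seminorm_mono:
  assumes X: "X \<in> H" and Y: "Y \<in> H" and le: "\<And>\<omega>. \<omega> \<in> space M \<Longrightarrow> \<bar>X \<omega>\<bar> \<le> \<bar>Y \<omega>\<bar>"
  shows "Lp_seminorm \<Theta> p X \<le> Lp_seminorm \<Theta> p Y"
proof (cases "Lp_seminorm \<Theta> p Y")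
  case (real c)
  show ?thesis
  proof (cases "p = \<top>")
    case True
    have "\<forall>\<theta>\<in>\<Theta>. AE \<omega> in \<theta>. \<bar>Y \<omega>\<bar> \<le> c"
      using real Lp_seminorm_le_iff_infinite[OF True real(1) H_measurable[OF Y]] by simp
    moreover have "AE \<omega> in \<theta>. \<bar>X \<omega>\<bar> \<le> c" if "\<theta> \<in> \<Theta>" "AE \<omega> in \<theta>. \<bar>Y \<omega>\<bar> \<le> c" for \<theta>
      using that(2) AE_space by eventually_elim (use le space_Theta[OF that(1)] order_trans in blast)
    ultimately have "\<forall>\<theta>\<in>\<Theta>. AE \<omega> in \<theta>. \<bar>X \<omega>\<bar> \<le> c"
      by blast
    then show ?thesis
      using real Lp_seminorm_le_iff_infinite[OF True real(1) H_measurable[OF X]] by simp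
  next
    case False
    have "upper_expectation \<Theta> (\<lambda>\<omega>. ennreal (\<bar>X \<omega>\<bar> powr enn2real p))
        \<le> upper_expectation \<Theta> (\<lambda>\<omega>. ennreal (\<bar>Y \<omega>\<bar> powr enn2real p))"
      using enn2real_p_ge_1[OF False] le
      by (intro upper_expectation_mono ennreal_leI powr_mono2) auto
    then show ?thesis
      using Lp_seminorm_le_iff_finite[OF False real(1), of X]
        Lp_seminorm_le_iff_finite[OF False real(1), of Y] real(2) by simp
  qed
qed simp

text \<open>Minkowski by normalisation: \<bar>x\<bar> + \<bar>y\<bar> is a + b times the convex
  combination of \<bar>x\<bar>/a and \<bar>y\<bar>/b with weights a/(a+b) and b/(a+b). Convexity of
  the power then reduces the claim to the two moment bounds.\<close>

lemma Lp_seminorm_add_le_real: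
  assumes X: "X \<in> H" and Y: "Y \<in> H" and ab: "0 < a" "0 < b"
    and Xa: "Lp_seminorm \<Theta> p X \<le> ennreal a" and Yb: "Lp_seminorm \<Theta> p Y \<le> ennreal b"
  shows "Lp_seminorm \<Theta> p (\<lambda>\<omega>. X \<omega> + Y \<omega>) \<le> ennreal (a + b)"
proof (cases "p = \<top>")
  case True
  have "\<forall>\<theta>\<in>\<Theta>. AE \<omega> in \<theta>. \<bar>X \<omega>\<bar> \<le> a" "\<forall>\<theta>\<in>\<Theta>. AE \<omega> in \<theta>. \<bar>Y \<omega>\<bar> \<le> b"
    using Xa Yb ab Lp_seminorm_le_iff_infinite[OF True _ H_measurable] X Y by auto
  then have "AE \<omega> in \<theta>. \<bar>X \<omega> + Y \<omega>\<bar> \<le> a + b" if "\<theta> \<in> \<Theta>" for \<theta>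
    using that by (auto elim!: ballE[of _ _ \<theta>] elim: eventually_elim2)
  then show ?thesis
    using ab by (subst Lp_seminorm_le_iff_infinite[OF True _ H_measurable[OF H_add[OF X Y]]]) auto
next
  case False
  let ?r = "enn2real p"
  note r = enn2real_p_ge_1[OF False]
  note [measurable] = H_measurable[OF X] H_measurable[OF Y]
  define \<alpha> \<beta> where "\<alpha> = a / (a + b)" and "\<beta> = b / (a + b)"
  have pos: "0 < \<alpha>" "0 < \<beta>" "\<alpha> + \<beta> = 1"
    unfolding \<alpha>_def \<beta>_def using ab by (simp_all flip: add_divide_distrib)
  \<comment> \<open>These absorb the normalisation, so that
    \<open>c * a powr ?r + d * b powr ?r\<close> equals \<open>(a + b) powr ?r\<close>.\<close>
  define c d where "c = (a + b) powr ?r * \<alpha> / a powr ?r" and "d = (a + b) powr ?r * \<beta> / b powr ?r"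
  have cd: "0 \<le> c" "0 \<le> d"
    unfolding c_def d_def using pos by simp_all
  have le: "\<bar>x + y\<bar> powr ?r \<le> c * \<bar>x\<bar> powr ?r + d * \<bar>y\<bar> powr ?r" for x y :: real
  proof -
    have "(a + b) * (\<alpha> * (\<bar>x\<bar> / a) + \<beta> * (\<bar>y\<bar> / b)) = \<bar>x\<bar> + \<bar>y\<bar>"
      using ab unfolding \<alpha>_def \<beta>_def by (simp add: distrib_left)
    then have "\<bar>x + y\<bar> powr ?r \<le> ((a + b) * (\<alpha> * (\<bar>x\<bar> / a) + \<beta> * (\<bar>y\<bar> / b))) powr ?r"
      using r by (intro powr_mono2) auto
    also have "\<dots> = (a + b) powr ?r * (\<alpha> * (\<bar>x\<bar> / a) + \<beta> * (\<bar>y\<bar> / b)) powr ?r"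
      by (intro powr_mult)
    also have "\<dots> \<le> (a + b) powr ?r * (\<alpha> * (\<bar>x\<bar> / a) powr ?r + \<beta> * (\<bar>y\<bar> / b) powr ?r)"
      using r ab pos by (intro mult_left_mono powr_convex_combination) auto
    also have "\<dots> = c * \<bar>x\<bar> powr ?r + d * \<bar>y\<bar> powr ?r"
      using ab unfolding c_def d_def by (simp add: powr_divide algebra_simps)
    finally show ?thesis .
  qed
  have "upper_expectation \<Theta> (\<lambda>\<omega>. ennreal (\<bar>X \<omega> + Y \<omega>\<bar> powr ?r))
      \<le> upper_expectation \<Theta> (\<lambda>\<omega>. ennreal c * ennreal (\<bar>X \<omega>\<bar> powr ?r) + ennreal d * ennreal (\<bar>Y \<omega>\<bar> powr ?r))"
    using le cd by (intro upper_expectation_mono) (simp flip: ennreal_mult ennreal_plus)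
  also have "\<dots> \<le> ennreal c * upper_expectation \<Theta> (\<lambda>\<omega>. ennreal (\<bar>X \<omega>\<bar> powr ?r)) +
      ennreal d * upper_expectation \<Theta> (\<lambda>\<omega>. ennreal (\<bar>Y \<omega>\<bar> powr ?r))"
    by (intro upper_expectation_combination) measurable
  also have "\<dots> \<le> ennreal c * ennreal (a powr ?r) + ennreal d * ennreal (b powr ?r)"
    using Xa Yb ab by (intro add_mono mult_left_mono) (simp_all add: Lp_seminorm_le_iff_finite[OF False])
  also have "\<dots> = ennreal (c * a powr ?r + d * b powr ?r)"
    using cd by (simp flip: ennreal_mult ennreal_plus)
  also have "c * a powr ?r + d * b powr ?r = (a + b) powr ?r * (\<alpha> + \<beta>)"
    unfolding c_def d_def using ab by (simp add: algebra_simps)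
  finally show ?thesis
    using ab pos by (simp add: Lp_seminorm_le_iff_finite[OF False] del: ennreal_plus)
qed

lemma Lp_seminorm_add_le:
  assumes X: "X \<in> H" and Y: "Y \<in> H"
  shows "Lp_seminorm \<Theta> p (\<lambda>\<omega>. X \<omega> + Y \<omega>) \<le> Lp_seminorm \<Theta> p X + Lp_seminorm \<Theta> p Y"
proof (rule ennreal_le_epsilon)
  fix e :: real
  assume "Lp_seminorm \<Theta> p X + Lp_seminorm \<Theta> p Y < \<top>" and e: "0 < e"
  then obtain a b where ab: "0 \<le> a" "Lp_seminorm \<Theta> p X = ennreal a"
    "0 \<le> b" "Lp_seminorm \<Theta> p Y = ennreal b"
    by (cases "Lp_seminorm \<Theta> p X"; cases "Lp_seminorm \<Theta> p Y") auto
  \<comment> \<open>Adding e/2 to each seminorm makes both bounds strictly positive, which covers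
    functions of seminorm zero.\<close>
  have "Lp_seminorm \<Theta> p (\<lambda>\<omega>. X \<omega> + Y \<omega>) \<le> ennreal ((a + e / 2) + (b + e / 2))"
    using ab e by (intro Lp_seminorm_add_le_real X Y) (auto intro: ennreal_leI)
  also have "\<dots> = Lp_seminorm \<Theta> p X + Lp_seminorm \<Theta> p Y + ennreal e"
    using ab e by (simp flip: ennreal_plus)
  finally show "Lp_seminorm \<Theta> p (\<lambda>\<omega>. X \<omega> + Y \<omega>) \<le> Lp_seminorm \<Theta> p X + Lp_seminorm \<Theta> p Y + ennreal e" .
qed

lemma Lp_seminorm_0: "Lp_seminorm \<Theta> p (\<lambda>_. 0) = 0"
proof (cases "p = \<top>")
  case True
  then show ?thesis
    using Lp_seminorm_le_iff_infinite[OF True order_refl, of "\<lambda>_. 0"] by simp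
next
  case False
  then show ?thesis
    using Lp_seminorm_le_iff_finite[OF False order_refl, of "\<lambda>_. 0"]
    by (simp add: upper_expectation_eq_0_iff)
qed

lemma Lp_seminorm_minus_commute:
  "Lp_seminorm \<Theta> p (\<lambda>\<omega>. X \<omega> - Y \<omega>) = Lp_seminorm \<Theta> p (\<lambda>\<omega>. Y \<omega> - X \<omega>)"
  by (simp add: Lp_seminorm_def abs_minus_commute)

section \<open>Contractivity of \<open>\<E> t\<close> in the seminorm\<close>

lemma Lp_seminorm_E_le:
  assumes X: "X \<in> H" and nonneg: "\<And>\<omega>. \<omega> \<in> space M \<Longrightarrow> 0 \<le> X \<omega>"
  shows "Lp_seminorm \<Theta> p (\<E> t X) \<le> Lp_seminorm \<Theta> p X"
proof (cases "Lp_seminorm \<Theta> p X")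
  case (real c)
  show ?thesis
  proof (cases "p = \<top>")
    case True
    \<comment> \<open>For nonnegative functions the two-sided bound becomes the one-sided bound that
      \<open>AE_E_le\<close> handles.\<close>
    have AE_abs: "(AE \<omega> in \<theta>. \<bar>Y \<omega>\<bar> \<le> c) \<longleftrightarrow> (AE \<omega> in \<theta>. Y \<omega> \<le> c)"
      if "\<theta> \<in> \<Theta>" "\<And>\<omega>. \<omega> \<in> space M \<Longrightarrow> 0 \<le> Y \<omega>" for \<theta> Y
      using that by (intro AE_cong) (simp add: space_Theta)
    have "\<forall>\<theta>\<in>\<Theta>. AE \<omega> in \<theta>. X \<omega> \<le> c"
      using real Lp_seminorm_le_iff_infinite[OF True real(1) H_measurable[OF X]] nonneg AE_abs by simp
    then have "\<forall>\<theta>\<in>\<Theta>. AE \<omega> in \<theta>. \<E> t X \<omega> \<le> c"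
      using AE_E_le[OF X] by blast
    then have "\<forall>\<theta>\<in>\<Theta>. AE \<omega> in \<theta>. \<bar>\<E> t X \<omega>\<bar> \<le> c"
      using AE_abs[of _ "\<E> t X"] E_nonneg[OF X nonneg] by blast
    then show ?thesis
      using real Lp_seminorm_le_iff_infinite[OF True real(1) H_measurable[OF E_H[OF X]]] by simp
  next
    case False
    note r = enn2real_p_ge_1[OF False]
    have "upper_expectation \<Theta> (\<lambda>\<omega>. ennreal (\<bar>\<E> t X \<omega>\<bar> powr enn2real p))
        \<le> upper_expectation \<Theta> (\<lambda>\<omega>. ennreal (\<E> t X \<omega> powr enn2real p))"
      by (intro upper_expectation_mono) (simp add: E_nonneg[OF X nonneg])
    also have "\<dots> \<le> upper_expectation \<Theta> (\<lambda>\<omega>. ennreal (X \<omega> powr enn2real p))"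
      by (intro upper_expectation_powr_E_le X nonneg r)
    also have "\<dots> \<le> upper_expectation \<Theta> (\<lambda>\<omega>. ennreal (\<bar>X \<omega>\<bar> powr enn2real p))"
      by (intro upper_expectation_mono) (simp add: nonneg)
    finally show ?thesis
      using Lp_seminorm_le_iff_finite[OF False real(1), of X]
        Lp_seminorm_le_iff_finite[OF False real(1), of "\<E> t X"] real(2) by simp
  qed
qed simp

text \<open>The absolute difference is dominated by \<open>\<E> t\<close> of the nonnegative
  function \<bar>X - Y\<bar>, to which Jensen's inequality applies.\<close>

lemma Lp_seminorm_E_diff_le:
  assumes X: "X \<in> H" and Y: "Y \<in> H"
  shows "Lp_seminorm \<Theta> p (\<lambda>\<omega>. \<E> t X \<omega> - \<E> t Y \<omega>) \<le> Lp_seminorm \<Theta> p (\<lambda>\<omega>. X \<omega> - Y \<omega>)"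
proof -
  have "Lp_seminorm \<Theta> p (\<lambda>\<omega>. \<E> t X \<omega> - \<E> t Y \<omega>) \<le> Lp_seminorm \<Theta> p (\<E> t (\<lambda>\<omega>. \<bar>X \<omega> - Y \<omega>\<bar>))"
    by (intro Lp_seminorm_mono H_diff E_H H_abs X Y order_trans[OF abs_E_diff_le[OF X Y] abs_ge_self])
  also have "\<dots> \<le> Lp_seminorm \<Theta> p (\<lambda>\<omega>. \<bar>X \<omega> - Y \<omega>\<bar>)"
    by (intro Lp_seminorm_E_le H_abs H_diff X Y) simp
  also have "\<dots> \<le> Lp_seminorm \<Theta> p (\<lambda>\<omega>. X \<omega> - Y \<omega>)"
    by (intro Lp_seminorm_mono H_abs H_diff X Y) simp
  finally show ?thesis .
qed

lemma Hp_diff: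
  assumes "X \<in> Hp H \<Theta> p" "Y \<in> Hp H \<Theta> p"
  shows "(\<lambda>\<omega>. X \<omega> - Y \<omega>) \<in> Hp H \<Theta> p"
proof -
  have H: "X \<in> H" "Y \<in> H" using assms by (auto simp: Hp_def)
  have "Lp_seminorm \<Theta> p (\<lambda>\<omega>. X \<omega> - Y \<omega>)
      \<le> Lp_seminorm \<Theta> p X + Lp_seminorm \<Theta> p (\<lambda>\<omega>. - Y \<omega>)"
    using Lp_seminorm_add_le[OF H(1) H_scale[OF H(2), of "-1"]] by simp
  also have "Lp_seminorm \<Theta> p (\<lambda>\<omega>. - Y \<omega>) = Lp_seminorm \<Theta> p Y"
    by (simp add: Lp_seminorm_def)
  also have "Lp_seminorm \<Theta> p X + Lp_seminorm \<Theta> p Y < \<top>"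
    using assms by (simp add: Hp_def)
  finally show ?thesis
    using H_diff[OF H] by (simp add: Hp_def)
qed

lemma Hp_E:
  assumes "X \<in> Hp H \<Theta> p"
  shows "\<E> t X \<in> Hp H \<Theta> p"
proof -
  have X: "X \<in> H" using assms by (simp add: Hp_def)
  \<comment> \<open>Contractivity is used with Y = 0. As \<open>\<E> t\<close> of 0 is known to be 0
    only on the state space, the comparison goes through monotonicity of the seminorm.\<close>
  have "Lp_seminorm \<Theta> p (\<E> t X) \<le> Lp_seminorm \<Theta> p (\<lambda>\<omega>. \<E> t X \<omega> - \<E> t (\<lambda>_. 0) \<omega>)"
    by (intro Lp_seminorm_mono H_diff E_H X H_const) (simp add: E_const)
  also have "\<dots> \<le> Lp_seminorm \<Theta> p X"
    using Lp_seminorm_E_diff_le[OF X H_const[of 0], of t] by simp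
  also have "\<dots> < \<top>"
    using assms by (simp add: Hp_def)
  finally show ?thesis
    using E_H[OF X] by (simp add: Hp_def)
qed

subsection \<open>The completion\<close>

text \<open>The real-valued expression inside \<open>Lp_dist\<close>. On \<open>Hp\<close> the
  seminorm of a difference is finite, so \<open>enn2real\<close> loses nothing.\<close>

definition Hp_dist :: "('a \<Rightarrow> real) \<Rightarrow> ('a \<Rightarrow> real) \<Rightarrow> real" where
  "Hp_dist X Y = enn2real (Lp_seminorm \<Theta> p (\<lambda>\<omega>. X \<omega> - Y \<omega>))"

lemma Lp_seminorm_eq_Hp_dist:
  assumes "X \<in> Hp H \<Theta> p" "Y \<in> Hp H \<Theta> p"
  shows "Lp_seminorm \<Theta> p (\<lambda>\<omega>. X \<omega> - Y \<omega>) = ennreal (Hp_dist X Y)"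
  using Hp_diff[OF assms] by (simp add: Hp_dist_def Hp_def)

lemma Hp_dist_nonneg [simp]: "0 \<le> Hp_dist X Y"
  by (simp add: Hp_dist_def)

lemma Hp_dist_refl [simp]: "Hp_dist X X = 0"
  by (simp add: Hp_dist_def Lp_seminorm_0)

lemma Hp_dist_commute: "Hp_dist X Y = Hp_dist Y X"
  unfolding Hp_dist_def by (subst Lp_seminorm_minus_commute) simp

lemma Hp_dist_triangle:
  assumes X: "X \<in> Hp H \<Theta> p" and Y: "Y \<in> Hp H \<Theta> p" and Z: "Z \<in> Hp H \<Theta> p"
  shows "Hp_dist X Z \<le> Hp_dist X Y + Hp_dist Y Z"
proof -
  have "(\<lambda>\<omega>. X \<omega> - Y \<omega>) \<in> H" "(\<lambda>\<omega>. Y \<omega> - Z \<omega>) \<in> H"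
    using assms by (auto simp: Hp_def intro: H_diff)
  from Lp_seminorm_add_le[OF this]
  have "ennreal (Hp_dist X Z) \<le> ennreal (Hp_dist X Y) + ennreal (Hp_dist Y Z)"
    by (simp add: Lp_seminorm_eq_Hp_dist assms)
  then show ?thesis
    by (simp flip: ennreal_plus)
qed

lemma Hp_dist_E_le:
  assumes "X \<in> Hp H \<Theta> p" "Y \<in> Hp H \<Theta> p"
  shows "Hp_dist (\<E> t X) (\<E> t Y) \<le> Hp_dist X Y"
proof -
  have "X \<in> H" "Y \<in> H" using assms by (auto simp: Hp_def)
  from Lp_seminorm_E_diff_le[OF this, of t] show ?thesis
    by (simp add: Lp_seminorm_eq_Hp_dist assms Hp_E)
qed

lemma Hp_Cauchy_iff:
  "Xs \<in> Hp_Cauchy H \<Theta> p \<longleftrightarrow> (\<forall>n. Xs n \<in> Hp H \<Theta> p) \<and>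
    (\<forall>e>0. \<exists>N. \<forall>m\<ge>N. \<forall>n\<ge>N. Hp_dist (Xs m) (Xs n) < e)"
proof -
  have "(\<forall>e>0. \<exists>N. \<forall>m\<ge>N. \<forall>n\<ge>N. Lp_seminorm \<Theta> p (\<lambda>\<omega>. Xs m \<omega> - Xs n \<omega>) < e) \<longleftrightarrow>
      (\<forall>e>0. \<exists>N. \<forall>m\<ge>N. \<forall>n\<ge>N. Hp_dist (Xs m) (Xs n) < e)" (is "?L \<longleftrightarrow> ?R")
    if Xs: "\<forall>n. Xs n \<in> Hp H \<Theta> p"
  proof
    assume L: ?L
    show ?R
    proof (intro allI impI)
      fix e :: real assume "0 < e"
      then have "0 < ennreal e" by simp
      with L obtain N where "\<forall>m\<ge>N. \<forall>n\<ge>N. Lp_seminorm \<Theta> p (\<lambda>\<omega>. Xs m \<omega> - Xs n \<omega>) < ennreal e"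
        by blast
      then show "\<exists>N. \<forall>m\<ge>N. \<forall>n\<ge>N. Hp_dist (Xs m) (Xs n) < e"
        using Xs by (auto simp: Lp_seminorm_eq_Hp_dist ennreal_less_iff)
    qed
  next
    assume R: ?R
    show ?L
    proof (intro allI impI)
      fix e :: ennreal assume "0 < e"
      \<comment> \<open>Since e may be infinite, a finite positive radius below it is
        chosen.\<close>
      then obtain r where r: "0 < ennreal r" "ennreal r < e"
      proof -
        from dense[OF \<open>0 < e\<close>] obtain z where "0 < z" "z < e" by blast
        then show ?thesis using that by (cases z) auto
      qed
      from r(1) have "0 < r" by simp
      with R obtain N where "\<forall>m\<ge>N. \<forall>n\<ge>N. Hp_dist (Xs m) (Xs n) < r"
        by blast
      then have "\<forall>m\<ge>N. \<forall>n\<ge>N. Lp_seminorm \<Theta> p (\<lambda>\<omega>. Xs m \<omega> - Xs n \<omega>) < ennreal r"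
        using Xs by (auto simp: Lp_seminorm_eq_Hp_dist ennreal_less_iff)
      then show "\<exists>N. \<forall>m\<ge>N. \<forall>n\<ge>N. Lp_seminorm \<Theta> p (\<lambda>\<omega>. Xs m \<omega> - Xs n \<omega>) < e"
        using r(2) by (meson order.strict_trans)
    qed
  qed
  then show ?thesis
    unfolding Hp_Cauchy_def by blast
qed

lemma Hp_Cauchy_in_Hp: "Xs \<in> Hp_Cauchy H \<Theta> p \<Longrightarrow> Xs n \<in> Hp H \<Theta> p"
  by (simp add: Hp_Cauchy_iff)

lemma Hp_equiv_iff:
  "(Xs, Ys) \<in> Hp_equiv H \<Theta> p \<longleftrightarrow> Xs \<in> Hp_Cauchy H \<Theta> p \<and> Ys \<in> Hp_Cauchy H \<Theta> p \<and>
    (\<lambda>n. Hp_dist (Xs n) (Ys n)) \<longlonglongrightarrow> 0"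
  using tendsto_ennreal_iff[of "\<lambda>n. Hp_dist (Xs n) (Ys n)" sequentially 0]
  by (auto simp: Hp_equiv_def Lp_seminorm_eq_Hp_dist Hp_Cauchy_in_Hp)

lemma Hp_equivI:
  assumes "Xs \<in> Hp_Cauchy H \<Theta> p" "Ys \<in> Hp_Cauchy H \<Theta> p" "f \<longlonglongrightarrow> 0"
    and "\<And>n. Hp_dist (Xs n) (Ys n) \<le> f n"
  shows "(Xs, Ys) \<in> Hp_equiv H \<Theta> p"
  unfolding Hp_equiv_iff using assms
  by (auto intro: tendsto_sandwich[of "\<lambda>_. 0" _ _ f])

lemma equiv_Hp: "equiv (Hp_Cauchy H \<Theta> p) (Hp_equiv H \<Theta> p)"
proof (rule equivI)
  show "Hp_equiv H \<Theta> p \<subseteq> Hp_Cauchy H \<Theta> p \<times> Hp_Cauchy H \<Theta> p"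
    by (auto simp: Hp_equiv_def)
  show "refl_on (Hp_Cauchy H \<Theta> p) (Hp_equiv H \<Theta> p)"
    by (auto simp: refl_on_def Hp_equiv_iff)
  show "sym (Hp_equiv H \<Theta> p)"
    by (auto simp: sym_def Hp_equiv_iff Hp_dist_commute)
  show "trans (Hp_equiv H \<Theta> p)"
  proof (rule transI)
    fix Xs Ys Zs
    assume "(Xs, Ys) \<in> Hp_equiv H \<Theta> p" "(Ys, Zs) \<in> Hp_equiv H \<Theta> p"
    then have C: "Xs \<in> Hp_Cauchy H \<Theta> p" "Ys \<in> Hp_Cauchy H \<Theta> p" "Zs \<in> Hp_Cauchy H \<Theta> p"
      and "(\<lambda>n. Hp_dist (Xs n) (Ys n)) \<longlonglongrightarrow> 0" "(\<lambda>n. Hp_dist (Ys n) (Zs n)) \<longlonglongrightarrow> 0"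
      by (auto simp: Hp_equiv_iff)
    then have "(\<lambda>n. Hp_dist (Xs n) (Ys n) + Hp_dist (Ys n) (Zs n)) \<longlonglongrightarrow> 0"
      using tendsto_add_zero by blast
    then show "(Xs, Zs) \<in> Hp_equiv H \<Theta> p"
      by (rule Hp_equivI[OF C(1,3)])
         (intro Hp_dist_triangle Hp_Cauchy_in_Hp[OF C(1)] Hp_Cauchy_in_Hp[OF C(2)]
           Hp_Cauchy_in_Hp[OF C(3)])
  qed
qed

lemma Hp_dist_diff_le:
  assumes "X \<in> Hp H \<Theta> p" "Y \<in> Hp H \<Theta> p" "X' \<in> Hp H \<Theta> p" "Y' \<in> Hp H \<Theta> p"
  shows "\<bar>Hp_dist X Y - Hp_dist X' Y'\<bar> \<le> Hp_dist X X' + Hp_dist Y Y'"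
  using Hp_dist_triangle[of X X' Y] Hp_dist_triangle[of X' Y' Y]
    Hp_dist_triangle[of X' X Y'] Hp_dist_triangle[of X Y Y'] assms
  by (simp add: Hp_dist_commute abs_le_iff)

lemma convergent_Hp_dist:
  assumes "Xs \<in> Hp_Cauchy H \<Theta> p" "Ys \<in> Hp_Cauchy H \<Theta> p"
  shows "convergent (\<lambda>n. Hp_dist (Xs n) (Ys n))"
proof (rule Cauchy_convergent, rule CauchyI)
  fix e :: real assume "0 < e"
  then have "0 < e / 2" by simp
  obtain N where N: "\<And>m n. m \<ge> N \<Longrightarrow> n \<ge> N \<Longrightarrow> Hp_dist (Xs m) (Xs n) < e / 2"
    using assms(1) \<open>0 < e / 2\<close> unfolding Hp_Cauchy_iff by meson
  obtain N' where N': "\<And>m n. m \<ge> N' \<Longrightarrow> n \<ge> N' \<Longrightarrow> Hp_dist (Ys m) (Ys n) < e / 2"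
    using assms(2) \<open>0 < e / 2\<close> unfolding Hp_Cauchy_iff by meson
  have "norm (Hp_dist (Xs m) (Ys m) - Hp_dist (Xs n) (Ys n)) < e"
    if "m \<ge> max N N'" "n \<ge> max N N'" for m n
    using Hp_dist_diff_le[of "Xs m" "Ys m" "Xs n" "Ys n"] N[of m n] N'[of m n] that
      Hp_Cauchy_in_Hp[OF assms(1)] Hp_Cauchy_in_Hp[OF assms(2)] by simp
  then show "\<exists>N. \<forall>m\<ge>N. \<forall>n\<ge>N. norm (Hp_dist (Xs m) (Ys m) - Hp_dist (Xs n) (Ys n)) < e"
    by blast
qed

section \<open>Classes of Cauchy sequences and their metric\<close>

lemma Lp_in_Hp_Cauchy: "A \<in> Lp H \<Theta> p \<Longrightarrow> Xs \<in> A \<Longrightarrow> Xs \<in> Hp_Cauchy H \<Theta> p"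
  unfolding Lp_def using in_quotient_imp_subset[OF equiv_Hp] by blast

lemma Lp_equiv: "A \<in> Lp H \<Theta> p \<Longrightarrow> Xs \<in> A \<Longrightarrow> Ys \<in> A \<Longrightarrow> (Xs, Ys) \<in> Hp_equiv H \<Theta> p"
  unfolding Lp_def using in_quotient_imp_in_rel[OF equiv_Hp] by blast

lemma Lp_closed: "A \<in> Lp H \<Theta> p \<Longrightarrow> Xs \<in> A \<Longrightarrow> (Xs, Ys) \<in> Hp_equiv H \<Theta> p \<Longrightarrow> Ys \<in> A"
  unfolding Lp_def using in_quotient_imp_closed[OF equiv_Hp] by blast

lemma Lp_eqI: "A \<in> Lp H \<Theta> p \<Longrightarrow> B \<in> Lp H \<Theta> p \<Longrightarrow> Xs \<in> A \<Longrightarrow> Ys \<in> B \<Longrightarrow>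
    (Xs, Ys) \<in> Hp_equiv H \<Theta> p \<Longrightarrow> A = B"
  unfolding Lp_def using quotient_eqI[OF equiv_Hp] by blast

lemma Lp_nonempty: "A \<in> Lp H \<Theta> p \<Longrightarrow> \<exists>Xs. Xs \<in> A"
  unfolding Lp_def using in_quotient_imp_non_empty[OF equiv_Hp] by blast

lemma Lp_class:
  assumes "Xs \<in> Hp_Cauchy H \<Theta> p"
  shows "Hp_equiv H \<Theta> p `` {Xs} \<in> Lp H \<Theta> p" "Xs \<in> Hp_equiv H \<Theta> p `` {Xs}"
  using assms equiv_class_self[OF equiv_Hp] by (auto simp: Lp_def intro: quotientI)

text \<open>Justifies the definite description in \<open>Lp_dist\<close>. The limit exists for one
  pair of representatives because the distances form a real Cauchy sequence, and
  \<open>Hp_dist_diff_le\<close> shows that equivalent representatives have the same limit.\<close>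

lemma Lp_dist_tendsto:
  assumes A: "A \<in> Lp H \<Theta> p" and B: "B \<in> Lp H \<Theta> p" and Xs: "Xs \<in> A" and Ys: "Ys \<in> B"
  shows "(\<lambda>n. Hp_dist (Xs n) (Ys n)) \<longlonglongrightarrow> Lp_dist H \<Theta> p A B"
proof -
  let ?P = "\<lambda>d. \<forall>Xs\<in>A. \<forall>Ys\<in>B. (\<lambda>n. Hp_dist (Xs n) (Ys n)) \<longlonglongrightarrow> d"
  note in_Hp = Hp_Cauchy_in_Hp[OF Lp_in_Hp_Cauchy]
  obtain d where d: "(\<lambda>n. Hp_dist (Xs n) (Ys n)) \<longlonglongrightarrow> d"
    using convergent_Hp_dist[OF Lp_in_Hp_Cauchy[OF A Xs] Lp_in_Hp_Cauchy[OF B Ys]]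
    by (auto simp: convergent_def)
  have "?P d"
  proof (intro ballI)
    fix Xs' Ys' assume Xs': "Xs' \<in> A" and Ys': "Ys' \<in> B"
    have "(\<lambda>n. Hp_dist (Xs' n) (Xs n) + Hp_dist (Ys' n) (Ys n)) \<longlonglongrightarrow> 0"
      using Lp_equiv[OF A Xs' Xs] Lp_equiv[OF B Ys' Ys] tendsto_add_zero
      by (auto simp: Hp_equiv_iff)
    then have "(\<lambda>n. Hp_dist (Xs' n) (Ys' n) - Hp_dist (Xs n) (Ys n)) \<longlonglongrightarrow> 0"
      by (rule Lim_null_comparison[rotated])
         (use in_Hp[OF A Xs] in_Hp[OF A Xs'] in_Hp[OF B Ys] in_Hp[OF B Ys']
          in \<open>auto intro!: always_eventually Hp_dist_diff_le\<close>)
    from tendsto_add[OF this d] show "(\<lambda>n. Hp_dist (Xs' n) (Ys' n)) \<longlonglongrightarrow> d"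
      by simp
  qed
  then have "?P (THE d. ?P d)"
  proof (rule theI)
    show "d' = d" if "?P d'" for d'
      using that Xs Ys by (intro LIMSEQ_unique[OF _ d]) blast
  qed
  then show ?thesis
    using A B Xs Ys by (auto simp: Lp_dist_def Hp_dist_def)
qed

text \<open>The axioms are inherited from \<open>Hp_dist\<close> by passing to limits along
  representatives; distance zero makes representatives equivalent, hence the classes equal.\<close>

lemma Metric_space_Lp: "Metric_space (Lp H \<Theta> p) (Lp_dist H \<Theta> p)"
proof
  fix A B
  show "0 \<le> Lp_dist H \<Theta> p A B"
  proof (cases "A \<in> Lp H \<Theta> p \<and> B \<in> Lp H \<Theta> p")
    case True
    with Lp_nonempty obtain Xs Ys where "Xs \<in> A" "Ys \<in> B" by meson
    from Lp_dist_tendsto[OF _ _ this] True show ?thesis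
      by (intro LIMSEQ_le_const) auto
  qed (auto simp: Lp_dist_def)
  show "Lp_dist H \<Theta> p A B = Lp_dist H \<Theta> p B A"
  proof (cases "A \<in> Lp H \<Theta> p \<and> B \<in> Lp H \<Theta> p")
    case True
    with Lp_nonempty obtain Xs Ys where XY: "Xs \<in> A" "Ys \<in> B" by meson
    from Lp_dist_tendsto[of B A, OF _ _ XY(2,1)] True
    have "(\<lambda>n. Hp_dist (Xs n) (Ys n)) \<longlonglongrightarrow> Lp_dist H \<Theta> p B A"
      by (simp add: Hp_dist_commute)
    with Lp_dist_tendsto[OF _ _ XY] True show ?thesis
      by (auto intro: LIMSEQ_unique)
  qed (auto simp: Lp_dist_def)
next
  fix A B assume AB: "A \<in> Lp H \<Theta> p" "B \<in> Lp H \<Theta> p"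
  with Lp_nonempty obtain Xs Ys where XY: "Xs \<in> A" "Ys \<in> B" by meson
  note lim = Lp_dist_tendsto[OF AB XY]
  show "Lp_dist H \<Theta> p A B = 0 \<longleftrightarrow> A = B"
  proof
    assume "Lp_dist H \<Theta> p A B = 0"
    then have "(Xs, Ys) \<in> Hp_equiv H \<Theta> p"
      using lim Lp_in_Hp_Cauchy AB XY by (auto simp: Hp_equiv_iff)
    then show "A = B"
      using Lp_eqI[OF AB XY] by blast
  next
    assume "A = B"
    then have "(\<lambda>n. Hp_dist (Xs n) (Ys n)) \<longlonglongrightarrow> 0"
      using Lp_equiv[OF AB(1)] XY by (auto simp: Hp_equiv_iff)
    with lim show "Lp_dist H \<Theta> p A B = 0"
      by (rule LIMSEQ_unique)
  qed
next
  fix A B C assume ABC: "A \<in> Lp H \<Theta> p" "B \<in> Lp H \<Theta> p" "C \<in> Lp H \<Theta> p"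
  with Lp_nonempty obtain Xs Ys Zs where XYZ: "Xs \<in> A" "Ys \<in> B" "Zs \<in> C" by meson
  show "Lp_dist H \<Theta> p A C \<le> Lp_dist H \<Theta> p A B + Lp_dist H \<Theta> p B C"
  proof (rule LIMSEQ_le)
    show "(\<lambda>n. Hp_dist (Xs n) (Zs n)) \<longlonglongrightarrow> Lp_dist H \<Theta> p A C"
      using ABC XYZ by (intro Lp_dist_tendsto)
    show "(\<lambda>n. Hp_dist (Xs n) (Ys n) + Hp_dist (Ys n) (Zs n))
        \<longlonglongrightarrow> Lp_dist H \<Theta> p A B + Lp_dist H \<Theta> p B C"
      using ABC XYZ by (intro tendsto_add Lp_dist_tendsto)
    show "\<exists>N. \<forall>n\<ge>N. Hp_dist (Xs n) (Zs n) \<le> Hp_dist (Xs n) (Ys n) + Hp_dist (Ys n) (Zs n)"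
      using ABC XYZ by (auto intro!: Hp_dist_triangle Hp_Cauchy_in_Hp Lp_in_Hp_Cauchy)
  qed
qed

section \<open>Convergence of embedded sequences\<close>

lemma Hp_Cauchy_const: "X \<in> Hp H \<Theta> p \<Longrightarrow> (\<lambda>_. X) \<in> Hp_Cauchy H \<Theta> p"
  by (auto simp: Hp_Cauchy_iff)

lemma Lp_embed:
  assumes "X \<in> Hp H \<Theta> p"
  shows "Lp_embed H \<Theta> p X \<in> Lp H \<Theta> p" "(\<lambda>_. X) \<in> Lp_embed H \<Theta> p X"
  unfolding Lp_embed_def using Lp_class[OF Hp_Cauchy_const[OF assms]] by auto

lemma converges_in_Lp_iff_dist:
  assumes "X \<in> Lp H \<Theta> p"
  shows "converges_in_Lp H \<Theta> p Xs X \<longleftrightarrow>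
    (\<forall>n. Xs n \<in> Hp H \<Theta> p) \<and> (\<lambda>n. Lp_dist H \<Theta> p (Lp_embed H \<Theta> p (Xs n)) X) \<longlonglongrightarrow> 0"
  unfolding converges_in_Lp_def Lp_topology_def
  using assms Lp_embed(1)
  by (auto simp: Metric_space.limitin_metric_dist_null[OF Metric_space_Lp])

text \<open>The distance from \<open>Xs n\<close> to a class is the limit over m of its distances to
  the m-th term of any representative. If these limits tend to 0, then \<open>Xs\<close> is
  asymptotic to a representative and so belongs to the class; conversely, for \<open>Xs\<close>
  itself as representative they tend to 0 by the Cauchy property.\<close>

lemma converges_in_Lp_iff:
  assumes X: "X \<in> Lp H \<Theta> p"
  shows "converges_in_Lp H \<Theta> p Xs X \<longleftrightarrow> Xs \<in> X"
proof
  assume conv: "converges_in_Lp H \<Theta> p Xs X"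
  obtain Ys where Ys: "Ys \<in> X"
    using Lp_nonempty[OF X] by blast
  note YC = Lp_in_Hp_Cauchy[OF X Ys]
  have Xs: "Xs n \<in> Hp H \<Theta> p" for n
    using conv by (simp add: converges_in_Lp_def)
  have lim: "(\<lambda>n. Hp_dist (Xs n) (Ys n)) \<longlonglongrightarrow> 0"
  proof (rule LIMSEQ_I)
    fix e :: real assume "0 < e"
    then have e: "0 < e / 2" by simp
    obtain N where N: "\<And>m n. m \<ge> N \<Longrightarrow> n \<ge> N \<Longrightarrow> Hp_dist (Ys m) (Ys n) < e / 2"
      using YC e unfolding Hp_Cauchy_iff by meson
    have "(\<lambda>n. Lp_dist H \<Theta> p (Lp_embed H \<Theta> p (Xs n)) X) \<longlonglongrightarrow> 0"
      using conv converges_in_Lp_iff_dist[OF X] by blast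
    then have "\<forall>\<^sub>F n in sequentially. Lp_dist H \<Theta> p (Lp_embed H \<Theta> p (Xs n)) X < e / 2"
      using e by (rule order_tendstoD(2))
    then obtain N' where N': "\<And>n. n \<ge> N' \<Longrightarrow> Lp_dist H \<Theta> p (Lp_embed H \<Theta> p (Xs n)) X < e / 2"
      unfolding eventually_sequentially by blast
    have "Hp_dist (Xs n) (Ys n) < e" if n: "n \<ge> max N N'" for n
    proof -
      \<comment> \<open>Here n is fixed and \<open>Xs n\<close> stands for its constant sequence; an
        index m that is also beyond the Cauchy threshold N of \<open>Ys\<close> then links
        \<open>Xs n\<close> to \<open>Ys n\<close>.\<close>
      have "(\<lambda>m. Hp_dist (Xs n) (Ys m)) \<longlonglongrightarrow> Lp_dist H \<Theta> p (Lp_embed H \<Theta> p (Xs n)) X"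
        using Lp_dist_tendsto[OF Lp_embed(1)[OF Xs] X Lp_embed(2)[OF Xs] Ys] .
      then have "\<forall>\<^sub>F m in sequentially. Hp_dist (Xs n) (Ys m) < e / 2"
        using N' n by (intro order_tendstoD(2)) auto
      then have "\<forall>\<^sub>F m in sequentially. Hp_dist (Xs n) (Ys m) < e / 2 \<and> m \<ge> N"
        using eventually_ge_at_top by (rule eventually_conj)
      then obtain m where m: "Hp_dist (Xs n) (Ys m) < e / 2" "m \<ge> N"
        using eventually_happens'[OF sequentially_bot] by blast
      have "Hp_dist (Xs n) (Ys n) \<le> Hp_dist (Xs n) (Ys m) + Hp_dist (Ys m) (Ys n)"
        by (intro Hp_dist_triangle Xs Hp_Cauchy_in_Hp[OF YC])
      with m N[of m n] n show ?thesis by simp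
    qed
    then show "\<exists>N. \<forall>n\<ge>N. norm (Hp_dist (Xs n) (Ys n) - 0) < e"
      by (intro exI[of _ "max N N'"]) simp
  qed
  have "Xs \<in> Hp_Cauchy H \<Theta> p"
    unfolding Hp_Cauchy_iff
  proof (intro conjI allI impI Xs)
    fix e :: real assume "0 < e"
    then have e: "0 < e / 3" by simp
    \<comment> \<open>One third of e bounds the oscillation of \<open>Ys\<close>; the other two
      bound the distance from \<open>Xs\<close> to \<open>Ys\<close> at the two indices.\<close>
    obtain N where N: "\<And>m n. m \<ge> N \<Longrightarrow> n \<ge> N \<Longrightarrow> Hp_dist (Ys m) (Ys n) < e / 3"
      using YC e unfolding Hp_Cauchy_iff by meson
    obtain N' where N': "\<And>n. n \<ge> N' \<Longrightarrow> Hp_dist (Xs n) (Ys n) < e / 3"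
      using order_tendstoD(2)[OF lim e] unfolding eventually_sequentially by blast
    have "Hp_dist (Xs m) (Xs n) < e" if "m \<ge> max N N'" "n \<ge> max N N'" for m n
      using Hp_dist_diff_le[of "Xs m" "Xs n" "Ys m" "Ys n"] N[of m n] N'[of m] N'[of n] that
        Xs Hp_Cauchy_in_Hp[OF YC] by simp
    then show "\<exists>N. \<forall>m\<ge>N. \<forall>n\<ge>N. Hp_dist (Xs m) (Xs n) < e"
      by blast
  qed
  then have "(Ys, Xs) \<in> Hp_equiv H \<Theta> p"
    using lim YC by (simp add: Hp_equiv_iff Hp_dist_commute)
  then show "Xs \<in> X"
    by (rule Lp_closed[OF X Ys])
next
  assume Xs: "Xs \<in> X"
  note C = Lp_in_Hp_Cauchy[OF X Xs]
  note in_Hp = Hp_Cauchy_in_Hp[OF C]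
  have "(\<lambda>n. Lp_dist H \<Theta> p (Lp_embed H \<Theta> p (Xs n)) X) \<longlonglongrightarrow> 0"
  proof (rule LIMSEQ_I)
    fix e :: real assume "0 < e"
    then have e: "0 < e / 2" by simp
    obtain N where N: "\<And>m n. m \<ge> N \<Longrightarrow> n \<ge> N \<Longrightarrow> Hp_dist (Xs m) (Xs n) < e / 2"
      using C e unfolding Hp_Cauchy_iff by meson
    \<comment> \<open>Passing to the limit preserves only the weak inequality; the bound e/2
      restores the strict one.\<close>
    have "\<bar>Lp_dist H \<Theta> p (Lp_embed H \<Theta> p (Xs n)) X\<bar> \<le> e / 2" if "n \<ge> N" for n
    proof -
      have "Lp_dist H \<Theta> p (Lp_embed H \<Theta> p (Xs n)) X \<le> e / 2"
        using Lp_dist_tendsto[OF Lp_embed(1)[OF in_Hp] X Lp_embed(2)[OF in_Hp] Xs]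
        by (rule LIMSEQ_le_const2) (use N[OF that] in \<open>auto intro!: exI[of _ N] less_imp_le\<close>)
      then show ?thesis
        using Metric_space.nonneg[OF Metric_space_Lp] by simp
    qed
    then show "\<exists>N. \<forall>n\<ge>N. norm (Lp_dist H \<Theta> p (Lp_embed H \<Theta> p (Xs n)) X - 0) < e"
      using \<open>0 < e\<close> by (intro exI[of _ N]) fastforce
  qed
  then show "converges_in_Lp H \<Theta> p Xs X"
    using in_Hp by (simp add: converges_in_Lp_iff_dist[OF X])
qed

section \<open>Extension of \<open>\<E> t\<close> to the completion\<close>

lemma Hp_Cauchy_E:
  assumes "Xs \<in> Hp_Cauchy H \<Theta> p"
  shows "(\<lambda>n. \<E> t (Xs n)) \<in> Hp_Cauchy H \<Theta> p"
  using assms Hp_dist_E_le unfolding Hp_Cauchy_iff by (meson Hp_E le_less_trans)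

lemma Hp_equiv_E:
  assumes "(Xs, Ys) \<in> Hp_equiv H \<Theta> p"
  shows "(\<lambda>n. \<E> t (Xs n), \<lambda>n. \<E> t (Ys n)) \<in> Hp_equiv H \<Theta> p"
  using assms by (intro Hp_equivI[where f = "\<lambda>n. Hp_dist (Xs n) (Ys n)"] Hp_Cauchy_E Hp_dist_E_le)
    (auto simp: Hp_equiv_iff intro: Hp_Cauchy_in_Hp)

text \<open>The image of one representative determines Y, since \<open>\<E> t\<close> maps
  equivalent sequences to equivalent ones. Any competitor contains the same image sequence, and
  classes with a common member coincide.\<close>

lemma ex1_Lp_E:
  assumes X: "X \<in> Lp H \<Theta> p"
  shows "\<exists>!Y. Y \<in> Lp H \<Theta> p \<and>
    (\<forall>Xs. converges_in_Lp H \<Theta> p Xs X \<longrightarrow> converges_in_Lp H \<Theta> p (\<lambda>n. \<E> t (Xs n)) Y)"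
proof -
  obtain Xs where Xs: "Xs \<in> X"
    using Lp_nonempty[OF X] by blast
  let ?Y = "Hp_equiv H \<Theta> p `` {\<lambda>n. \<E> t (Xs n)}"
  note Y = Lp_class[OF Hp_Cauchy_E[OF Lp_in_Hp_Cauchy[OF X Xs]], of t]
  show ?thesis
  proof (rule ex1I[of _ ?Y])
    have "(\<lambda>n. \<E> t (Zs n)) \<in> ?Y" if "Zs \<in> X" for Zs
      using Hp_equiv_E[OF Lp_equiv[OF X Xs that]] by simp
    then show "?Y \<in> Lp H \<Theta> p \<and>
        (\<forall>Zs. converges_in_Lp H \<Theta> p Zs X \<longrightarrow> converges_in_Lp H \<Theta> p (\<lambda>n. \<E> t (Zs n)) ?Y)"
      using Y(1) by (simp add: converges_in_Lp_iff X)
  next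
    fix Z
    assume Z: "Z \<in> Lp H \<Theta> p \<and>
        (\<forall>Zs. converges_in_Lp H \<Theta> p Zs X \<longrightarrow> converges_in_Lp H \<Theta> p (\<lambda>n. \<E> t (Zs n)) Z)"
    then have "(\<lambda>n. \<E> t (Xs n)) \<in> Z"
      using Xs converges_in_Lp_iff[OF X] converges_in_Lp_iff[of Z] by blast
    with Z Y show "Z = ?Y"
      using Lp_eqI[of Z ?Y] Lp_equiv[OF Y(1) Y(2) Y(2)] by blast
  qed
qed

end

theorem lemma3p1:
  fixes M :: "'a measure" and F :: "nat \<Rightarrow> 'a measure" and H :: "('a \<Rightarrow> real) set"
    and \<E> :: "nat \<Rightarrow> ('a \<Rightarrow> real) \<Rightarrow> 'a \<Rightarrow> real" and \<Theta> :: "'a measure set"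
    and p :: ennreal and t :: nat and X :: "(nat \<Rightarrow> 'a \<Rightarrow> real) set"
  assumes "represented_SL_expectation M F H \<E> \<Theta>"
    and "1 \<le> p"
    and "X \<in> Lp H \<Theta> p"
  shows "(\<forall>Xs. converges_in_Lp H \<Theta> p Xs X \<longrightarrow>
            (\<exists>Y \<in> Lp H \<Theta> p. converges_in_Lp H \<Theta> p (\<lambda>n. \<E> t (Xs n)) Y))
       \<and> (\<exists>!Y. Y \<in> Lp H \<Theta> p \<and>
            (\<forall>Xs. converges_in_Lp H \<Theta> p Xs X \<longrightarrow> converges_in_Lp H \<Theta> p (\<lambda>n. \<E> t (Xs n)) Y))"
proof -
  interpret SL_expectation_exponent M F H \<E> \<Theta> p
    using assms(1,2) by (simp add: SL_expectation_exponent_def SL_expectation_exponent_axioms_def)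
  \<comment> \<open>The unique Y of the second conjunct serves as the limit for every
    \<open>Xs\<close> in the first.\<close>
  show ?thesis
    using ex1_Lp_E[OF assms(3), of t] by blast
qed

end
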